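(* Let $R$ be a ring, $M$ a Tate $R$-module and $T:M\to M$ a topologically nilpotent automorphism (of Tate modules). Equip $M$ with the topological $R((t))$-module structure such that $tm=T(m)$ for $m\in M$. Then $M$ is a finitely generated projective $R((t))$-module, and the topology of $M$ is its standard topology.
   Context: Tate $R$-module: topological direct summand of $P\oplus Q^*$ with $P,Q$ discrete projective $R$-modules and $Q^*=\operatorname{Hom}_R(Q,R)$ with topology of pointwise convergence. A lattice in $M$ is an open submodule $L$ with $L/U$ finitely generated for every open submodule $U\subset L$. An endomorphism $T$ of $M$ is topologically nilpotent if for all lattices $L,L'\subset M$ there exists $N$ with $T^nL'\subset L$ for all $n>N$ (equivalently, there is a structure of topological $R[[t]]$-module on $M$ with $t$ acting as $T$). The standard topology on a finitely generated projective $R((t))$-module $N$ is the unique topological $R((t))$-module structure such that every $R((t))$-linear map $N\to R((t))$ is continuous, $R((t))$ having the topology with basis $t^nR[[t]]$. *)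

theory Defs
  imports "HOL-Analysis.Analysis" "HOL-Computational_Algebra.Formal_Laurent_Series"
begin

text \<open>Conventions. The ring R is a commutative ring, given as a type 'r of class comm_ring_1.
An R-module is a type 'm with an abelian group structure and a scalar multiplication
satisfying the locale module. The ring R always carries the discrete topology.\<close>

definition top_module :: "('r::comm_ring_1 \<Rightarrow> 'm::ab_group_add \<Rightarrow> 'm) \<Rightarrow> 'm topology \<Rightarrow> bool" where
  "top_module smul \<tau> \<longleftrightarrow> module smul \<and> topspace \<tau> = UNIV \<and>
     continuous_map (prod_topology \<tau> \<tau>) \<tau> (\<lambda>(x, y). x + y) \<and>
     continuous_map \<tau> \<tau> uminus \<and>
     (\<forall>r. continuous_map \<tau> \<tau> (smul r))"

text \<open>Projective R-module: the canonical surjection from the free module R^(P)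
(finitely supported functions P to R) onto P, sending f to the sum of f(y) y,
admits an R-linear section, i.e. P is a direct summand of a free module.\<close>
definition projective_module :: "('r::comm_ring_1 \<Rightarrow> 'p::ab_group_add \<Rightarrow> 'p) \<Rightarrow> bool" where
  "projective_module smul \<longleftrightarrow> module smul \<and>
     (\<exists>s :: 'p \<Rightarrow> ('p \<Rightarrow> 'r).
        (\<forall>x. finite {y. s x y \<noteq> 0}) \<and>
        (\<forall>x y. s (x + y) = (\<lambda>z. s x z + s y z)) \<and>
        (\<forall>r x. s (smul r x) = (\<lambda>z. r * s x z)) \<and>
        (\<forall>x. (\<Sum>y\<in>{y. s x y \<noteq> 0}. smul (s x y) y) = x))"

definition dual_module :: "('r::comm_ring_1 \<Rightarrow> 'q::ab_group_add \<Rightarrow> 'q) \<Rightarrow> ('q \<Rightarrow> 'r) set" where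
  "dual_module smul = {\<phi>. (\<forall>x y. \<phi> (x + y) = \<phi> x + \<phi> y) \<and> (\<forall>r x. \<phi> (smul r x) = r * \<phi> x)}"

definition sum_dual_topology :: "('r::comm_ring_1 \<Rightarrow> 'q::ab_group_add \<Rightarrow> 'q) \<Rightarrow> ('p \<times> ('q \<Rightarrow> 'r)) topology" where
  "sum_dual_topology scaleQ =
     prod_topology (discrete_topology UNIV)
       (subtopology (product_topology (\<lambda>_. discrete_topology UNIV) UNIV) (dual_module scaleQ))"

text \<open>M is a Tate R-module, witnessed by discrete projective P and Q: M is a topological
direct summand of P \<oplus> Q^*, i.e. there are continuous R-linear maps i : M \<rightarrow> P \<oplus> Q^*
and p : P \<oplus> Q^* \<rightarrow> M with p \<circ> i = id.\<close>
definition tate_module_via ::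
  "('r::comm_ring_1 \<Rightarrow> 'm::ab_group_add \<Rightarrow> 'm) \<Rightarrow> 'm topology \<Rightarrow>
   ('r \<Rightarrow> 'p::ab_group_add \<Rightarrow> 'p) \<Rightarrow> ('r \<Rightarrow> 'q::ab_group_add \<Rightarrow> 'q) \<Rightarrow> bool" where
  "tate_module_via smul \<tau> scaleP scaleQ \<longleftrightarrow>
     top_module smul \<tau> \<and> projective_module scaleP \<and> projective_module scaleQ \<and>
     (\<exists>(i :: 'm \<Rightarrow> 'p \<times> ('q \<Rightarrow> 'r)) (p :: 'p \<times> ('q \<Rightarrow> 'r) \<Rightarrow> 'm).
        continuous_map \<tau> (sum_dual_topology scaleQ) i \<and>
        continuous_map (sum_dual_topology scaleQ) \<tau> p \<and>
        (\<forall>x y. i (x + y) = (fst (i x) + fst (i y), \<lambda>q. snd (i x) q + snd (i y) q)) \<and>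
        (\<forall>r x. i (smul r x) = (scaleP r (fst (i x)), \<lambda>q. r * snd (i x) q)) \<and>
        (\<forall>a \<phi> b \<psi>. \<phi> \<in> dual_module scaleQ \<longrightarrow> \<psi> \<in> dual_module scaleQ \<longrightarrow>
            p (a + b, \<lambda>q. \<phi> q + \<psi> q) = p (a, \<phi>) + p (b, \<psi>)) \<and>
        (\<forall>r a \<phi>. \<phi> \<in> dual_module scaleQ \<longrightarrow>
            p (scaleP r a, \<lambda>q. r * \<phi> q) = smul r (p (a, \<phi>))) \<and>
        (\<forall>x. p (i x) = x))"

text \<open>Lattice: open submodule L such that L/U is finitely generated for every open
submodule U of L (L/U f.g.: L = span F + U for a finite F in L).\<close>
definition lattice :: "('r::comm_ring_1 \<Rightarrow> 'm::ab_group_add \<Rightarrow> 'm) \<Rightarrow> 'm topology \<Rightarrow> 'm set \<Rightarrow> bool" where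
  "lattice smul \<tau> L \<longleftrightarrow> openin \<tau> L \<and> module.subspace smul L \<and>
     (\<forall>U. openin \<tau> U \<and> module.subspace smul U \<and> U \<subseteq> L \<longrightarrow>
        (\<exists>F. finite F \<and> F \<subseteq> L \<and> L \<subseteq> {a + b | a b. a \<in> module.span smul F \<and> b \<in> U}))"

definition top_nilpotent :: "('r::comm_ring_1 \<Rightarrow> 'm::ab_group_add \<Rightarrow> 'm) \<Rightarrow> 'm topology \<Rightarrow> ('m \<Rightarrow> 'm) \<Rightarrow> bool" where
  "top_nilpotent smul \<tau> T \<longleftrightarrow>
     (\<forall>L L'. lattice smul \<tau> L \<and> lattice smul \<tau> L' \<longrightarrow>
        (\<exists>N::nat. \<forall>n>N. (T ^^ n) ` L' \<subseteq> L))"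

definition top_automorphism :: "('r::comm_ring_1 \<Rightarrow> 'm::ab_group_add \<Rightarrow> 'm) \<Rightarrow> 'm topology \<Rightarrow> ('m \<Rightarrow> 'm) \<Rightarrow> bool" where
  "top_automorphism smul \<tau> T \<longleftrightarrow> homeomorphic_map \<tau> \<tau> T \<and>
     (\<forall>x y. T (x + y) = T x + T y) \<and> (\<forall>r x. T (smul r x) = smul r (T x))"

definition fls_topology :: "('r::comm_ring_1) fls topology" where
  "fls_topology = topology (\<lambda>U. \<forall>f\<in>U. \<exists>n::int. {g. \<forall>k<n. fls_nth (g - f) k = 0} \<subseteq> U)"

definition top_fls_module :: "('r::comm_ring_1 fls \<Rightarrow> 'm::ab_group_add \<Rightarrow> 'm) \<Rightarrow> 'm topology \<Rightarrow> bool" where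
  "top_fls_module lscale \<tau> \<longleftrightarrow> module lscale \<and> topspace \<tau> = UNIV \<and>
     continuous_map (prod_topology \<tau> \<tau>) \<tau> (\<lambda>(x, y). x + y) \<and>
     continuous_map \<tau> \<tau> uminus \<and>
     continuous_map (prod_topology fls_topology \<tau>) \<tau> (\<lambda>(f, x). lscale f x)"

text \<open>Finitely generated projective R((t))-module: direct summand of R((t))^n
(R((t))^n realised as functions nat \<Rightarrow> R((t)) vanishing from n on).\<close>
definition fg_projective_fls :: "('r::comm_ring_1 fls \<Rightarrow> 'm::ab_group_add \<Rightarrow> 'm) \<Rightarrow> bool" where
  "fg_projective_fls lscale \<longleftrightarrow> module lscale \<and>
     (\<exists>(n::nat) (i :: 'm \<Rightarrow> nat \<Rightarrow> 'r fls) (p :: (nat \<Rightarrow> 'r fls) \<Rightarrow> 'm).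
        (\<forall>x k. n \<le> k \<longrightarrow> i x k = 0) \<and>
        (\<forall>x y. i (x + y) = (\<lambda>k. i x k + i y k)) \<and>
        (\<forall>c x. i (lscale c x) = (\<lambda>k. c * i x k)) \<and>
        (\<forall>v w. (\<forall>k\<ge>n. v k = 0) \<longrightarrow> (\<forall>k\<ge>n. w k = 0) \<longrightarrow>
            p (\<lambda>k. v k + w k) = p v + p w) \<and>
        (\<forall>c v. (\<forall>k\<ge>n. v k = 0) \<longrightarrow> p (\<lambda>k. c * v k) = lscale c (p v)) \<and>
        (\<forall>x. p (i x) = x))"

text \<open>Standard topology of a f.g. projective R((t))-module N: the (unique) topological
R((t))-module structure for which every R((t))-linear map N \<rightarrow> R((t)) is continuous.
This predicate says that tau is that topology.\<close>
definition is_standard_topology :: "('r::comm_ring_1 fls \<Rightarrow> 'm::ab_group_add \<Rightarrow> 'm) \<Rightarrow> 'm topology \<Rightarrow> bool" where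
  "is_standard_topology lscale \<tau> \<longleftrightarrow> top_fls_module lscale \<tau> \<and>
     (\<forall>\<phi> :: 'm \<Rightarrow> 'r fls. (\<forall>x y. \<phi> (x + y) = \<phi> x + \<phi> y) \<and> (\<forall>c x. \<phi> (lscale c x) = c * \<phi> x)
        \<longrightarrow> continuous_map \<tau> fls_topology \<phi>)"

end

theory Submission
  imports Defs
begin

text \<open>
  Let \<open>g\<close> be the endomorphism of \<open>M\<close> induced by the projection of \<open>P \<oplus> Q\<^sup>*\<close> onto \<open>Q\<^sup>*\<close>: its image is
  bounded and it is the identity on a neighbourhood of 0. The image of \<open>Q\<^sup>*\<close> in \<open>M\<close> generates a
  \<open>t\<close>-stable lattice \<open>L\<close> with \<open>L / tL\<close> finitely generated over \<open>R\<close>, hence \<open>L\<close> is finitely generated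
  over \<open>R[[t]]\<close> by successive approximation, and \<open>M\<close> is the union of the \<open>t\<^sup>-\<^sup>n L\<close>. This gives a
  surjection \<open>\<pi> : R((t))\<^sup>K \<rightarrow> M\<close> and, as the topology of \<open>M\<close> has the basis \<open>t\<^sup>n L\<close>, the continuity of
  every linear functional. In general \<open>L / tL\<close> is not projective, so \<open>\<pi>\<close> cannot be split over
  \<open>R[[t]]\<close>. It does have a bounded \<open>R\<close>-linear section \<open>s\<close>, because \<open>P\<close> and \<open>Q\<close> are projective. Put
  \<open>h = g - t g t\<^sup>-\<^sup>1\<close>, which has open kernel and bounded image. Then \<open>\<Sum>n. t\<^sup>n h t\<^sup>-\<^sup>n\<close>, over all
  integers \<open>n\<close>, telescopes to the identity, so \<open>\<Sum>n. t\<^sup>n s h t\<^sup>-\<^sup>n\<close> is an \<open>R((t))\<close>-linear section.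
\<close>

section \<open>Powers of t and the t-adic filtration of R((t))\<close>

text \<open>Writing t^n as a shift gives all integer exponents without an inverse on the coefficient
  ring.\<close>

definition tpow :: "int \<Rightarrow> 'r::comm_ring_1 fls" where
  "tpow n = fls_shift (- n) 1"

text \<open>The fractional ideal t^n R[[t]] of R((t)).\<close>

definition tadic :: "int \<Rightarrow> 'r::comm_ring_1 fls set" where
  "tadic n = {f. \<forall>k<n. fls_nth f k = 0}"

lemma tpow_mult_nth [simp]: "fls_nth (tpow m * f) k = fls_nth f (k - m)"
  by (simp add: tpow_def fls_X_intpow_times_conv_shift)

lemma tpow_nth [simp]: "fls_nth (tpow m) k = (if k = m then 1 else 0)"
  by (simp add: tpow_def)

lemma tpow_0 [simp]: "tpow 0 = 1"
  by (simp add: tpow_def)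

lemma tpow_add: "tpow (m + n) = tpow m * tpow n"
  by (simp add: fls_eq_iff algebra_simps)

lemma tpow_mult_inverse [simp]: "tpow n * tpow (- n) = 1" "tpow (- n) * tpow n = 1"
  by (simp_all flip: tpow_add)

lemma tadicI: "(\<And>k. k < n \<Longrightarrow> fls_nth f k = 0) \<Longrightarrow> f \<in> tadic n"
  by (simp add: tadic_def)

lemma tadicD: "f \<in> tadic n \<Longrightarrow> k < n \<Longrightarrow> fls_nth f k = 0"
  by (simp add: tadic_def)

lemma tadic_zero [simp]: "0 \<in> tadic n"
  by (simp add: tadic_def)

lemma tadic_add: "f \<in> tadic n \<Longrightarrow> g \<in> tadic n \<Longrightarrow> f + g \<in> tadic n"
  by (simp add: tadic_def)

lemma tadic_diff: "f \<in> tadic n \<Longrightarrow> g \<in> tadic n \<Longrightarrow> f - g \<in> tadic n"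
  by (simp add: tadic_def)

lemma tadic_sum: "(\<And>x. x \<in> A \<Longrightarrow> f x \<in> tadic n) \<Longrightarrow> sum f A \<in> tadic n"
  by (simp add: tadic_def fls_nth_sum)

lemma tadic_antimono: "f \<in> tadic n \<Longrightarrow> m \<le> n \<Longrightarrow> f \<in> tadic m"
  by (simp add: tadic_def)

lemma tadic_mult:
  assumes "f \<in> tadic m" "g \<in> tadic n"
  shows "f * g \<in> tadic (m + n)"
\<comment> \<open>\<open>fls_subdegree 0\<close> is 0, so the subdegree bounds fail for a zero
  factor when \<open>m\<close> or \<open>n\<close> is positive.\<close>
proof (cases "f = 0 \<or> g = 0")
  case False
  then have "m \<le> fls_subdegree f" "n \<le> fls_subdegree g"
    using assms by (auto intro!: fls_subdegree_geI simp: tadic_def)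
  then show ?thesis
    by (intro tadicI fls_times_nth_eq0) linarith
qed auto

lemma fls_const_tadic: "fls_const c \<in> tadic 0"
  by (simp add: tadic_def)

lemma tpow_tadic: "tpow n \<in> tadic n"
  by (simp add: tadic_def)

lemma tpow_tadic_ge: "m \<le> n \<Longrightarrow> tpow n \<in> tadic m"
  by (simp add: tadic_def)

lemma tadic_const_mult: "f \<in> tadic n \<Longrightarrow> fls_const c * f \<in> tadic n"
  using tadic_mult[OF fls_const_tadic, of f n c] by simp

lemma tpow_mult_tadic: "f \<in> tadic n \<Longrightarrow> tpow m * f \<in> tadic (m + n)"
  using tadic_mult[OF tpow_tadic] .

lemma fls_in_tadic: "\<exists>n. f \<in> tadic n"
  by (rule exI[of _ "fls_subdegree f"]) (simp add: tadic_def)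

lemma tadic_separated: "(\<And>n. f \<in> tadic n) \<Longrightarrow> f = 0"
  by (rule fls_eqI) (metis tadicD fls_zero_nth zless_add1_eq)

text \<open>This reduces a scalar to a Laurent polynomial, on which R-linearity and commutation with
  t decide everything. For n \<le> m the sum is empty and the claim is antimonotonicity.\<close>

lemma fls_truncation:
  assumes "f \<in> tadic m"
  shows "f - (\<Sum>j\<in>{m..<n}. fls_const (fls_nth f j) * tpow j) \<in> tadic n"
  using tadicD[OF assms] by (auto intro!: tadicI simp: fls_nth_sum if_distrib[of "(*) _"] cong: if_cong)

section \<open>Lattices over R[[t]] and lifting along their generators\<close>

text \<open>The algebraic shadow of an open bounded R[[t]]-submodule. \<open>xs_gen\<close> asks
  only that \<open>xs\<close> span L modulo tL over R, with no independence or projectivity.\<close>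

locale fls_lattice = module lscale
  for lscale :: "'r::comm_ring_1 fls \<Rightarrow> 'm::ab_group_add \<Rightarrow> 'm" +
  fixes L :: "'m set" and xs :: "nat \<Rightarrow> 'm" and K :: nat
  assumes L_zero: "0 \<in> L"
    and L_add: "x \<in> L \<Longrightarrow> y \<in> L \<Longrightarrow> x + y \<in> L"
    and L_scale: "f \<in> tadic 0 \<Longrightarrow> x \<in> L \<Longrightarrow> lscale f x \<in> L"
    and L_separated: "(\<And>n. lscale (tpow (- n)) x \<in> L) \<Longrightarrow> x = 0"
    and L_absorbing: "\<exists>n. lscale (tpow n) x \<in> L"
    and xs_in: "k < K \<Longrightarrow> xs k \<in> L"
    and xs_gen: "x \<in> L \<Longrightarrow>
      \<exists>r. lscale (tpow (- 1)) (x - (\<Sum>k<K. lscale (fls_const (r k)) (xs k))) \<in> L"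
begin

text \<open>The submodule t^n L.\<close>

definition fil :: "int \<Rightarrow> 'm set" where
  "fil n = {x. lscale (tpow (- n)) x \<in> L}"

text \<open>The surjection \<open>\<pi>\<close> from R((t))^K to M; only the coordinates below
  \<open>K\<close> are read.\<close>

definition comb :: "(nat \<Rightarrow> 'r fls) \<Rightarrow> 'm" where
  "comb v = (\<Sum>k<K. lscale (v k) (xs k))"

lemma fil_0: "fil 0 = L"
  by (simp add: fil_def)

lemma tpow_cancel [simp]: "lscale (tpow (- n)) (lscale (tpow n) x) = x"
  "lscale (tpow n) (lscale (tpow (- n)) x) = x"
  by simp_all

lemma fil_zero [simp]: "0 \<in> fil n"
  by (simp add: fil_def L_zero)

lemma fil_add: "x \<in> fil n \<Longrightarrow> y \<in> fil n \<Longrightarrow> x + y \<in> fil n"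
  by (simp add: fil_def scale_right_distrib L_add)

lemma fil_sum: "(\<And>x. x \<in> A \<Longrightarrow> f x \<in> fil n) \<Longrightarrow> sum f A \<in> fil n"
  by (induction A rule: infinite_finite_induct) (auto intro: fil_add)

lemma fil_scale:
  assumes "f \<in> tadic m" "x \<in> fil n"
  shows "lscale f x \<in> fil (m + n)"
proof -
  have "tpow (- m) * f \<in> tadic 0"
    using tpow_mult_tadic[OF assms(1), of "- m"] by simp
  then have "lscale (tpow (- m) * f) (lscale (tpow (- n)) x) \<in> L"
    by (rule L_scale) (use assms(2) in \<open>simp add: fil_def\<close>)
  moreover have "tpow (- (m + n)) = (tpow (- m) * tpow (- n) :: 'r fls)"
    using tpow_add[of "- m" "- n"] by simp
  then have "tpow (- m) * f * tpow (- n) = tpow (- (m + n)) * f"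
    by (simp add: ac_simps)
  ultimately show ?thesis
    by (simp add: fil_def)
qed

lemma fil_const: "x \<in> fil n \<Longrightarrow> lscale (fls_const c) x \<in> fil n"
  using fil_scale[OF fls_const_tadic] by force

lemma fil_tpow: "x \<in> fil n \<Longrightarrow> lscale (tpow m) x \<in> fil (m + n)"
  using fil_scale[OF tpow_tadic] .

lemma fil_uminus: "x \<in> fil n \<Longrightarrow> - x \<in> fil n"
proof -
  assume "x \<in> fil n"
  then have "lscale (fls_const (- 1)) x \<in> fil n"
    by (rule fil_const)
  moreover have "fls_const (- 1 :: 'r) = - 1"
    by (simp add: fls_eq_iff)
  ultimately show ?thesis
    by simp
qed

lemma fil_diff: "x \<in> fil n \<Longrightarrow> y \<in> fil n \<Longrightarrow> x - y \<in> fil n"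
  using fil_add[of x n "- y"] fil_uminus by simp

lemma fil_antimono: "x \<in> fil n \<Longrightarrow> m \<le> n \<Longrightarrow> x \<in> fil m"
  \<comment> \<open>As m - n \<le> 0, the scalar 1 lies in t^(m-n) R[[t]].\<close>
  using fil_scale[of 1 "m - n" x n] tpow_tadic_ge[of "m - n" 0] by simp

lemma fil_separated: "(\<And>n. x \<in> fil n) \<Longrightarrow> x = 0"
  using L_separated by (simp add: fil_def)

lemma fil_separated_eq: "(\<And>n. n \<ge> 0 \<Longrightarrow> x - y \<in> fil n) \<Longrightarrow> x = y"
  using fil_separated[of "x - y"] fil_antimono[of "x - y"]
  by (metis eq_iff_diff_eq_0 linear)

lemma fil_absorbing: "\<exists>n. x \<in> fil n"
  using L_absorbing[of x] by (metis fil_def mem_Collect_eq minus_minus)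

lemma comb_add: "comb (\<lambda>k. v k + w k) = comb v + comb w"
  by (simp add: comb_def scale_left_distrib sum.distrib)

lemma comb_diff: "comb (\<lambda>k. v k - w k) = comb v - comb w"
  by (simp add: comb_def scale_left_diff_distrib sum_subtractf)

lemma comb_scale: "comb (\<lambda>k. c * v k) = lscale c (comb v)"
  by (simp add: comb_def scale_sum_right)

lemma comb_sum: "comb (\<lambda>k. \<Sum>y\<in>A. v y k) = (\<Sum>y\<in>A. comb (v y))"
  by (simp add: comb_def scale_sum_left) (rule sum.swap)

lemma comb_fil:
  assumes "\<And>k. k < K \<Longrightarrow> v k \<in> tadic n"
  shows "comb v \<in> fil n"
  unfolding comb_def
proof (rule fil_sum)
  fix k assume "k \<in> {..<K}"
  then show "lscale (v k) (xs k) \<in> fil n"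
    using fil_scale[of "v k" n "xs k" 0] assms xs_in by (simp add: fil_0)
qed

text \<open>Successive approximation; the series is summed in the scalars, so completeness of the module
  is not needed, only separatedness.\<close>
lemma lift_L:
  assumes "z \<in> L"
  obtains v where "\<And>k. v k \<in> tadic 0" "\<And>k. k \<ge> K \<Longrightarrow> v k = 0" "comb v = z"
proof -
  \<comment> \<open>One approximation step. The implication makes it total in \<open>x\<close>, so
    that choice yields functions \<open>r\<close> and \<open>nx\<close> that can be
    iterated.\<close>
  have "\<exists>r y. x \<in> L \<longrightarrow> y \<in> L \<and> x = comb (\<lambda>k. fls_const (r k)) + lscale (tpow 1) y" for x
  proof (cases "x \<in> L")
    case True
    then obtain r where r: "lscale (tpow (- 1)) (x - comb (\<lambda>k. fls_const (r k))) \<in> L"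
      using xs_gen unfolding comb_def by blast
    show ?thesis
      by (rule exI[of _ r], rule exI[of _ "lscale (tpow (- 1)) (x - comb (\<lambda>k. fls_const (r k)))"])
         (use r in auto)
  qed auto
  then obtain r nx where nx: "\<And>x. x \<in> L \<Longrightarrow> nx x \<in> L"
    "\<And>x. x \<in> L \<Longrightarrow> x = comb (\<lambda>k. fls_const (r x k)) + lscale (tpow 1) (nx x)"
    by metis
  define zs where "zs n = (nx ^^ n) z" for n
  have zs_in: "zs n \<in> L" for n
    by (induction n) (auto simp: zs_def assms nx)
  define w where "w n k = (\<Sum>j<n. fls_const (r (zs j) k) * tpow (int j))" for n k
  have approx: "z = comb (w n) + lscale (tpow (int n)) (zs n)" for n
  proof (induction n)
    case 0
    then show ?case by (simp add: w_def comb_def zs_def)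
  next
    case (Suc n)
    have "lscale (tpow (int n)) (zs n) =
        lscale (tpow (int n)) (comb (\<lambda>k. fls_const (r (zs n) k)) + lscale (tpow 1) (zs (Suc n)))"
      using nx(2)[OF zs_in[of n]] by (simp add: zs_def)
    also have "\<dots> = comb (\<lambda>k. tpow (int n) * fls_const (r (zs n) k))
        + lscale (tpow (int (Suc n))) (zs (Suc n))"
      by (simp add: scale_right_distrib comb_scale add.commute[of 1] tpow_add)
    finally show ?case
      using Suc comb_add[of "w n" "\<lambda>k. tpow (int n) * fls_const (r (zs n) k)"]
      by (simp add: w_def[abs_def] mult.commute[of "tpow _"])
  qed
  \<comment> \<open>The digits found at all steps, collected into K power series; \<open>w n\<close>
    holds their first n terms.\<close>
  define v where "v k = (if k < K then fps_to_fls (Abs_fps (\<lambda>j. r (zs j) k)) else 0)" for k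
  have "comb v = z"
  proof (rule fil_separated_eq)
    fix n :: int assume "n \<ge> 0"
    then obtain m where m: "n = int m"
      by (metis nonneg_eq_int)
    have "comb (\<lambda>k. v k - w m k) \<in> fil n"
    proof (intro comb_fil tadicI)
      fix k j assume "k < K" "j < n"
      show "fls_nth (v k - w m k) j = 0"
      proof (cases j)
        case (nonneg i)
        then show ?thesis
          using \<open>k < K\<close> \<open>j < n\<close>
          by (simp add: v_def w_def fls_nth_sum m if_distrib[of "(*) _"] cong: if_cong)
      qed (simp add: v_def w_def fls_nth_sum)
    qed
    moreover have "lscale (tpow (int m)) (zs m) \<in> fil n"
      using fil_tpow[of "zs m" 0 n] zs_in by (simp add: fil_0 m)
    ultimately have "comb (\<lambda>k. v k - w m k) - lscale (tpow (int m)) (zs m) \<in> fil n"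
      by (rule fil_diff)
    moreover have "comb (\<lambda>k. v k - w m k) - lscale (tpow (int m)) (zs m) = comb v - z"
      using approx[of m] by (simp add: comb_diff algebra_simps)
    ultimately show "comb v - z \<in> fil n"
      by simp
  qed
  moreover have "v k \<in> tadic 0" for k
    by (auto intro: tadicI simp: v_def)
  ultimately show ?thesis
    using that[of v] by (simp add: v_def)
qed

text \<open>One lift serves all steps of the filtration at once: take the largest n with x in t^n L,
  lift t^(-n) x to power series, and multiply back by t^n. Only x = 0 has no largest n, and it lifts
  to 0.\<close>

lemma lift_filtered:
  obtains v where "\<And>n k. x \<in> fil n \<Longrightarrow> v k \<in> tadic n" "\<And>k. k \<ge> K \<Longrightarrow> v k = 0" "comb v = x"
proof (cases "x = 0")
  case True
  then show ?thesis
    using that[of "\<lambda>_. 0"] by (simp add: comb_def)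
next
  case False
  obtain a where a: "x \<in> fil a"
    using fil_absorbing by blast
  obtain b where b: "x \<notin> fil b"
    using fil_separated False by blast
  then have "a \<le> b"
    using a fil_antimono[of x a b] by linarith
  then have ex: "\<exists>d. x \<notin> fil (a + int d)"
    using b by (intro exI[of _ "nat (b - a)"]) simp
  \<comment> \<open>The first step from \<open>a\<close> onwards that \<open>x\<close> misses; it is
    positive since \<open>x\<close> lies in \<open>fil a\<close>, so the step before it is the last
    one containing \<open>x\<close>.\<close>
  define d where "d = (LEAST d. x \<notin> fil (a + int d))"
  have d: "x \<notin> fil (a + int d)"
    unfolding d_def using ex by (rule LeastI_ex)
  have d_min: "x \<in> fil (a + int e)" if "e < d" for e
    using not_less_Least[of e "\<lambda>d. x \<notin> fil (a + int d)"] that unfolding d_def by blast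
  have "d \<noteq> 0"
    using d a by (intro notI) simp
  define n where "n = a + int d - 1"
  have n: "x \<in> fil n"
    using d_min[of "d - 1"] \<open>d \<noteq> 0\<close> by (simp add: n_def of_nat_diff algebra_simps)
  have max: "m \<le> n" if "x \<in> fil m" for m
    using d fil_antimono[OF that, of "a + int d"] unfolding n_def by linarith
  obtain v where v: "\<And>k. v k \<in> tadic 0" "\<And>k. k \<ge> K \<Longrightarrow> v k = 0" "comb v = lscale (tpow (- n)) x"
    using lift_L n unfolding fil_def by blast
  show ?thesis
  proof (rule that)
    show "tpow n * v k \<in> tadic m" if "x \<in> fil m" for m k
      using tadic_antimono[OF tpow_mult_tadic[OF v(1), of n k], of m] max[OF that] by simp
    show "tpow n * v k = 0" if "k \<ge> K" for k
      using v(2) that by simp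
    show "comb (\<lambda>k. tpow n * v k) = x"
      by (simp add: comb_scale v)
  qed
qed

section \<open>Boundedness of linear maps\<close>

text \<open>Finitely many values on the generators have a common bound, and an element of t^n L
  lifts to coefficients in t^n R[[t]]. This gives the continuity of linear functionals.\<close>

lemma linear_bounded:
  assumes \<phi>: "\<And>x y. \<phi> (x + y) = \<phi> x + \<phi> y" "\<And>c x. \<phi> (lscale c x) = c * \<phi> x"
  shows "\<exists>A. \<forall>n. \<forall>x\<in>fil n. \<phi> x \<in> tadic (n - A)"
proof -
  interpret \<phi>: additive \<phi>
    by standard (rule \<phi>)
  have "\<exists>A. \<forall>k<N. \<phi> (xs k) \<in> tadic (- A)" for N
  proof (induction N)
    case (Suc N)
    then obtain A where "\<forall>k<N. \<phi> (xs k) \<in> tadic (- A)"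
      by blast
    moreover obtain B where "\<phi> (xs N) \<in> tadic B"
      using fls_in_tadic by blast
    ultimately have "\<forall>k<Suc N. \<phi> (xs k) \<in> tadic (- max A (- B))"
      by (auto simp: less_Suc_eq intro: tadic_antimono)
    then show ?case by blast
  qed auto
  then obtain A where A: "\<And>k. k < K \<Longrightarrow> \<phi> (xs k) \<in> tadic (- A)"
    by blast
  show ?thesis
  proof (intro exI allI ballI)
    fix n x assume x: "x \<in> fil n"
    obtain v where v: "\<And>k. v k \<in> tadic n" "comb v = x"
      using lift_filtered[of x] x by metis
    have "(\<Sum>k<K. v k * \<phi> (xs k)) \<in> tadic (n - A)"
      using tadic_mult[OF v(1) A] by (intro tadic_sum) simp
    then show "\<phi> x \<in> tadic (n - A)"
      by (simp flip: v(2) add: comb_def \<phi>.sum \<phi>(2))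
  qed
qed

text \<open>L modulo t^d L is generated over R by the finitely many t^j xs_k with 0 \<le> j < d, and
  their images have a common bound.\<close>

lemma vanishing_bounded:
  assumes \<sigma>: "\<And>x y. \<sigma> (x + y) = \<sigma> x + \<sigma> y" "\<And>r x. \<sigma> (lscale (fls_const r) x) = fls_const r * \<sigma> x"
    and vanish: "\<And>x. x \<in> fil d \<Longrightarrow> \<sigma> x = 0"
  shows "\<exists>B. \<forall>x\<in>L. \<sigma> x \<in> tadic B"
proof -
  interpret \<sigma>: additive \<sigma>
    by standard (rule \<sigma>)
  have bdd: "\<exists>B. \<forall>z\<in>F. \<sigma> z \<in> tadic B" if "finite F" for F
    using that
  proof (induction F)
    case (insert z F)
    then obtain A where "\<forall>z\<in>F. \<sigma> z \<in> tadic A"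
      by blast
    moreover obtain B where "\<sigma> z \<in> tadic B"
      using fls_in_tadic by blast
    ultimately have "\<forall>z\<in>insert z F. \<sigma> z \<in> tadic (min A B)"
      by (auto intro: tadic_antimono)
    then show ?case by blast
  qed auto
  define F where "F = (\<lambda>(j, k). lscale (tpow j) (xs k)) ` ({0..<d} \<times> {..<K})"
  have "finite F"
    by (simp add: F_def)
  then obtain B where B: "\<And>z. z \<in> F \<Longrightarrow> \<sigma> z \<in> tadic B"
    using bdd by blast
  show ?thesis
  proof (intro exI ballI)
    fix x assume "x \<in> L"
    then obtain v where v: "\<And>k. v k \<in> tadic 0" "comb v = x"
      using lift_L by metis
    define w where "w k = (\<Sum>j\<in>{0..<d}. fls_const (fls_nth (v k) j) * tpow j)" for k
    have "comb (\<lambda>k. v k - w k) \<in> fil d"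
      unfolding w_def by (intro comb_fil fls_truncation v)
    then have "\<sigma> (comb v) = \<sigma> (comb w)"
      using vanish[of "comb v - comb w"] by (simp add: comb_diff \<sigma>.diff)
    also have "\<dots> = (\<Sum>k<K. \<Sum>j\<in>{0..<d}. fls_const (fls_nth (v k) j) * \<sigma> (lscale (tpow j) (xs k)))"
      by (simp add: comb_def w_def \<sigma>.sum scale_sum_left \<sigma>(2) flip: scale_scale)
    also have "\<dots> \<in> tadic B"
      by (intro tadic_sum tadic_const_mult B) (auto simp: F_def)
    finally show "\<sigma> x \<in> tadic B"
      by (simp add: v)
  qed
qed

section \<open>Averaging an R-linear map over conjugation by powers of t\<close>

text \<open>Compatibility with constants and powers of t gives linearity over Laurent polynomials;
  boundedness extends it to series, because the error of a truncation lies in every t^N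
  R[[t]].\<close>

lemma linear_if_tpow_linear:
  assumes \<Phi>: "\<And>x y. \<Phi> (x + y) = \<Phi> x + \<Phi> y" "\<And>r x. \<Phi> (lscale (fls_const r) x) = fls_const r * \<Phi> x"
    "\<And>m x. \<Phi> (lscale (tpow m) x) = tpow m * \<Phi> x"
    and bounded: "\<And>n x. x \<in> fil n \<Longrightarrow> \<Phi> x \<in> tadic (n - A)"
  shows "\<Phi> (lscale f x) = f * \<Phi> x"
proof -
  interpret \<Phi>: additive \<Phi>
    by standard (rule \<Phi>)
  have "\<Phi> (lscale f x) - f * \<Phi> x \<in> tadic N" for N
  proof -
    obtain m where m: "f \<in> tadic m"
      using fls_in_tadic by blast
    obtain a where a: "x \<in> fil a"
      using fil_absorbing by blast
    \<comment> \<open>With this truncation order both \<open>\<Phi> ((f - p) x)\<close> and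
      \<open>(f - p) * \<Phi> x\<close> land in t^N R[[t]], as n + a - A = N.\<close>
    define n where "n = N + A - a"
    define p where "p = (\<Sum>j\<in>{m..<n}. fls_const (fls_nth f j) * tpow j)"
    have fp: "f - p \<in> tadic n"
      using fls_truncation[OF m] by (simp add: p_def)
    have "\<Phi> (lscale p x) = p * \<Phi> x"
      by (simp add: p_def scale_sum_left \<Phi>.sum \<Phi>(2,3) sum_distrib_right mult.assoc flip: scale_scale)
    then have "\<Phi> (lscale f x) - f * \<Phi> x = \<Phi> (lscale (f - p) x) - (f - p) * \<Phi> x"
      by (simp add: scale_left_diff_distrib \<Phi>.diff algebra_simps)
    also have "\<dots> \<in> tadic N"
      using bounded[OF fil_scale[OF fp a]] tadic_mult[OF fp bounded[OF a]]
      by (intro tadic_diff) (simp_all add: n_def)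
    finally show ?thesis .
  qed
  then show ?thesis
    using tadic_separated[of "\<Phi> (lscale f x) - f * \<Phi> x"] by simp
qed

text \<open>\<open>\<Phi>\<close> is the sum of \<open>t\<^sup>n H t\<^sup>-\<^sup>n\<close> over all integers \<open>n\<close>, which converges for
  \<open>n \<rightarrow> -\<infinity>\<close> since \<open>H\<close> has open kernel and for \<open>n \<rightarrow> \<infinity>\<close> since \<open>H\<close> has bounded image.\<close>
lemma average:
  assumes H: "\<And>x y. H (x + y) = H x + H y" "\<And>r x. H (lscale (fls_const r) x) = fls_const r * H x"
    and vanish: "\<And>x. x \<in> fil d \<Longrightarrow> H x = 0"
    and bounded: "\<And>x. H x \<in> tadic B"
  shows "\<exists>\<Phi>. (\<forall>x y. \<Phi> (x + y) = \<Phi> x + \<Phi> y) \<and> (\<forall>c x. \<Phi> (lscale c x) = c * \<Phi> x) \<and>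
    (\<forall>x a lo hi. x \<in> fil a \<longrightarrow> lo \<le> a - d \<longrightarrow>
      \<Phi> x - (\<Sum>n\<in>{lo..hi}. tpow n * H (lscale (tpow (- n)) x)) \<in> tadic (hi + B))"
proof -
  \<comment> \<open>The coefficient of t^j in the summand t^n H(t^(-n) x). For fixed
    \<open>x\<close> and \<open>j\<close> it is nonzero for finitely many \<open>n\<close>
    only.\<close>
  define c where "c x j n = fls_nth (H (lscale (tpow (- n)) x)) (j - n)" for x and j n :: int
  have c_lo: "c x j n = 0" if "x \<in> fil a" "n \<le> a - d" for x j n a
    using vanish[of "lscale (tpow (- n)) x"] fil_antimono[OF fil_tpow[OF that(1), of "- n"], of d] that(2)
    by (simp add: c_def)
  have c_hi: "c x j n = 0" if "n > j - B" for x j n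
    using tadicD[OF bounded, of "j - n" "lscale (tpow (- n)) x"] that by (simp add: c_def)
  define \<Phi> where "\<Phi> x = Abs_fls (\<lambda>j. sum (c x j) {n. c x j n \<noteq> 0})" for x
  have \<Phi>_nth: "fls_nth (\<Phi> x) j = (\<Sum>n\<in>{lo..hi}. c x j n)"
    if x: "x \<in> fil a" and "lo \<le> a - d + 1" "j - B \<le> hi" for x j lo hi a
  proof -
    have "fls_nth (\<Phi> x) j = sum (c x j) {n. c x j n \<noteq> 0}"
      unfolding \<Phi>_def
    \<comment> \<open>Below degree a - d + B the two vanishing ranges n \<le> a - d and n > j - B
      cover all integers.\<close>
    proof (rule nth_Abs_fls_lower_bound[of "a - d + B"], intro allI impI)
      fix i assume "i < a - d + B"
      then have "c x i n = 0" for n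
        using c_lo[OF x, of n i] c_hi[where x = x and j = i and n = n] by linarith
      then show "sum (c x i) {n. c x i n \<noteq> 0} = 0"
        by simp
    qed
    also have "\<dots> = (\<Sum>n\<in>{lo..hi}. c x j n)"
    proof (rule sum.mono_neutral_left)
      show "{n. c x j n \<noteq> 0} \<subseteq> {lo..hi}"
      proof
        fix n assume "n \<in> {n. c x j n \<noteq> 0}"
        then show "n \<in> {lo..hi}"
          using c_lo[OF x, of n j] c_hi[where x = x and j = j and n = n] that(2,3) by fastforce
      qed
    qed auto
    finally show ?thesis .
  qed
  have add: "\<Phi> (x + y) = \<Phi> x + \<Phi> y" for x y
  proof (rule fls_eqI)
    fix j
    obtain a b where ab: "x \<in> fil a" "y \<in> fil b"
      using fil_absorbing by blast
    define m where "m = min a b"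
    have m: "x \<in> fil m" "y \<in> fil m" "x + y \<in> fil m"
      using ab fil_antimono[of x a m] fil_antimono[of y b m] fil_add by (auto simp: m_def)
    show "fls_nth (\<Phi> (x + y)) j = fls_nth (\<Phi> x + \<Phi> y) j"
      using m by (simp add: \<Phi>_nth[where a = m and lo = "m - d" and hi = "j - B"] c_def
          scale_right_distrib H sum.distrib)
  qed
  have const: "\<Phi> (lscale (fls_const r) x) = fls_const r * \<Phi> x" for r x
  proof (rule fls_eqI)
    fix j
    obtain a where a: "x \<in> fil a"
      using fil_absorbing by blast
    show "fls_nth (\<Phi> (lscale (fls_const r) x)) j = fls_nth (fls_const r * \<Phi> x) j"
      using a fil_const[OF a, of r]
      by (simp add: \<Phi>_nth[where a = a and lo = "a - d" and hi = "j - B"] c_def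
          scale_left_commute[of _ "fls_const r"] H sum_distrib_left del: scale_scale)
  qed
  have tpow: "\<Phi> (lscale (tpow m) x) = tpow m * \<Phi> x" for m x
  proof (rule fls_eqI)
    fix j
    obtain a where a: "x \<in> fil a"
      using fil_absorbing by blast
    have "fls_nth (\<Phi> (lscale (tpow m) x)) j = (\<Sum>n\<in>{a - d + m..j - B}. c (lscale (tpow m) x) j n)"
      by (rule \<Phi>_nth[OF fil_tpow[OF a]]) simp_all
    \<comment> \<open>Since the sum runs over all integers, shifting the index by \<open>m\<close>
      permutes the summands; this is what makes \<open>\<Phi>\<close> commute with t^m.\<close>
    also have "\<dots> = (\<Sum>n\<in>{a - d..j - m - B}. c x (j - m) n)"
      by (rule sum.reindex_bij_witness[of _ "\<lambda>n. n + m" "\<lambda>n. n - m"])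
         (auto simp: c_def algebra_simps simp flip: tpow_add)
    also have "\<dots> = fls_nth (\<Phi> x) (j - m)"
      by (rule \<Phi>_nth[OF a, symmetric]) simp_all
    finally show "fls_nth (\<Phi> (lscale (tpow m) x)) j = fls_nth (tpow m * \<Phi> x) j"
      by simp
  qed
  have bdd: "\<Phi> x \<in> tadic (n - (d - B))" if "x \<in> fil n" for n x
  proof (rule tadicI)
    fix j assume "j < n - (d - B)"
    then show "fls_nth (\<Phi> x) j = 0"
      by (subst \<Phi>_nth[OF that, of "n - d + 1" j "j - B"]) auto
  qed
  show ?thesis
  proof (rule exI[of _ \<Phi>], intro conjI allI impI)
    show "\<Phi> (lscale c x) = c * \<Phi> x" for c x
      using add const tpow bdd by (rule linear_if_tpow_linear)
    \<comment> \<open>Summands with n > hi contribute nothing to degrees j < hi + B.\<close>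
    show "\<Phi> x - (\<Sum>n\<in>{lo..hi}. tpow n * H (lscale (tpow (- n)) x)) \<in> tadic (hi + B)"
      if "x \<in> fil a" "lo \<le> a - d" for x a lo hi
    proof (rule tadicI)
      fix j assume "j < hi + B"
      then show "fls_nth (\<Phi> x - (\<Sum>n\<in>{lo..hi}. tpow n * H (lscale (tpow (- n)) x))) j = 0"
        using \<Phi>_nth[OF that(1), of lo j hi] that(2) by (simp add: fls_nth_sum c_def)
    qed
  qed (rule add)
qed

section \<open>R-linear lifts and the R((t))-linear splitting\<close>

text \<open>R-linear maps from M to R((t))^K, with R embedded as the constant series.\<close>

definition const_linear :: "('m \<Rightarrow> nat \<Rightarrow> 'r fls) \<Rightarrow> bool" where
  "const_linear s \<longleftrightarrow> (\<forall>x y k. s (x + y) k = s x k + s y k) \<and>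
    (\<forall>r x k. s (lscale (fls_const r) x) k = fls_const r * s x k) \<and> (\<forall>x k. k \<ge> K \<longrightarrow> s x k = 0)"

lemma const_linearD:
  assumes "const_linear s"
  shows "s (x + y) k = s x k + s y k" "s (lscale (fls_const r) x) k = fls_const r * s x k"
    "k \<ge> K \<Longrightarrow> s x k = 0"
  using assms by (simp_all add: const_linear_def)

text \<open>Lifts of the \<open>e y\<close> keep their filtration degree, so the lifted series
  converges along with the original one. The \<open>z\<close>-dependence sits in the coefficients
  \<open>b y z\<close>, which makes the lift R-linear. This treats the part of M coming from the
  dual of Q.\<close>

lemma lift_convergent_sum:
  assumes b: "\<And>y x z. b y (x + z) = b y x + b y z" "\<And>y r x. b y (lscale (fls_const r) x) = r * b y x"
    and e_in: "\<And>y. e y \<in> L"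
    and approx: "\<And>n. \<exists>J. finite J \<and> (\<forall>y. y \<notin> J \<longrightarrow> e y \<in> fil n) \<and>
      (\<forall>z. g z - (\<Sum>y\<in>J. lscale (fls_const (b y z)) (e y)) \<in> fil n)"
  shows "\<exists>G. const_linear G \<and> (\<forall>x k. G x k \<in> tadic 0) \<and> (\<forall>x. comb (G x) = g x)"
proof -
  have "\<forall>y. \<exists>v. (\<forall>n k. e y \<in> fil n \<longrightarrow> v k \<in> tadic n) \<and> (\<forall>k\<ge>K. v k = 0) \<and> comb v = e y"
  proof
    fix y
    show "\<exists>v. (\<forall>n k. e y \<in> fil n \<longrightarrow> v k \<in> tadic n) \<and> (\<forall>k\<ge>K. v k = 0) \<and> comb v = e y"
      by (rule lift_filtered[of "e y"]) blast
  qed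
  then obtain E where E: "\<And>y n k. e y \<in> fil n \<Longrightarrow> E y k \<in> tadic n" "\<And>y k. k \<ge> K \<Longrightarrow> E y k = 0"
    "\<And>y. comb (E y) = e y"
    by metis
  \<comment> \<open>The smallest index set usable modulo t^n L. Unlike the sets from
    \<open>approx\<close> it is canonical and increases with \<open>n\<close>.\<close>
  define Y where "Y n = {y. e y \<notin> fil n}" for n
  have finite_Y: "finite (Y n)" for n
    using approx[of n] by (auto simp: Y_def intro: finite_subset)
  have Y_approx: "g z - (\<Sum>y\<in>Y n. lscale (fls_const (b y z)) (e y)) \<in> fil n" for z n
  proof -
    obtain J where J: "finite J" "\<And>y. y \<notin> J \<Longrightarrow> e y \<in> fil n"
      "g z - (\<Sum>y\<in>J. lscale (fls_const (b y z)) (e y)) \<in> fil n"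
      using approx by blast
    have "Y n \<subseteq> J"
      using J(2) by (auto simp: Y_def)
    have "(\<Sum>y\<in>J - Y n. lscale (fls_const (b y z)) (e y)) \<in> fil n"
      by (rule fil_sum) (auto simp: Y_def intro: fil_const)
    from fil_add[OF J(3) this] show ?thesis
      by (simp add: sum.subset_diff[OF \<open>Y n \<subseteq> J\<close> J(1)])
  qed
  have Y_mono: "Y m \<subseteq> Y n" if "m \<le> n" for m n
    using fil_antimono that by (auto simp: Y_def)
  \<comment> \<open>For the coefficient of t^j the indices in \<open>Y (j + 1)\<close> suffice: any
    other \<open>e y\<close> lies in t^(j+1) L, and so its lift has no term of degree j.\<close>
  define G where "G z k = fps_to_fls (Abs_fps (\<lambda>j. \<Sum>y\<in>Y (int j + 1). b y z * fls_nth (E y k) (int j)))"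
    for z k
  have comb_G: "comb (G z) = g z" for z
  proof (rule fil_separated_eq)
    fix n :: int assume "n \<ge> 0"
    have "comb (\<lambda>k. G z k - (\<Sum>y\<in>Y n. fls_const (b y z) * E y k)) \<in> fil n"
    proof (intro comb_fil tadicI)
      fix k j assume "k < K" "j < n"
      show "fls_nth (G z k - (\<Sum>y\<in>Y n. fls_const (b y z) * E y k)) j = 0"
      proof (cases "j < 0")
        case True
        then show ?thesis
          using tadicD[OF E(1)[of _ 0 k]] e_in by (simp add: G_def fls_nth_sum fil_0)
      next
        case False
        have "(\<Sum>y\<in>Y (j + 1). b y z * fls_nth (E y k) j) = (\<Sum>y\<in>Y n. b y z * fls_nth (E y k) j)"
        proof (rule sum.mono_neutral_left)
          show "\<forall>y\<in>Y n - Y (j + 1). b y z * fls_nth (E y k) j = 0"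
            using tadicD[OF E(1), of _ "j + 1" j k] by (simp add: Y_def)
        qed (use Y_mono \<open>j < n\<close> finite_Y in auto)
        then show ?thesis
          using False by (simp add: G_def fls_nth_sum)
      qed
    qed
    then have "comb (G z) - (\<Sum>y\<in>Y n. lscale (fls_const (b y z)) (e y)) \<in> fil n"
      by (simp add: comb_diff comb_sum comb_scale E)
    from fil_diff[OF this Y_approx[of z n]] show "comb (G z) - g z \<in> fil n"
      by simp
  qed
  have "const_linear G"
    unfolding const_linear_def
  proof (intro conjI allI impI)
    show "G (x + y) k = G x k + G y k" for x y k
      by (simp add: G_def fls_eq_iff b sum.distrib distrib_right)
    show "G (lscale (fls_const r) x) k = fls_const r * G x k" for r x k
      by (simp add: G_def fls_eq_iff b sum_distrib_left mult.assoc)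
    show "G x k = 0" if "k \<ge> K" for x k
      using that by (simp add: G_def fls_eq_iff E)
  qed
  moreover have "G x k \<in> tadic 0" for x k
    by (auto intro: tadicI simp: G_def)
  ultimately show ?thesis
    using comb_G by blast
qed

text \<open>For the part of M coming from P each sum is finite, so arbitrary lifts of the
  \<open>u p\<close> will do.\<close>

lemma lift_finite_sum:
  assumes a: "\<And>p x z. a p (x + z) = a p x + a p z" "\<And>p r x. a p (lscale (fls_const r) x) = r * a p x"
    and a_fin: "\<And>x. finite {p. a p x \<noteq> 0}"
  shows "\<exists>S. const_linear S \<and>
    (\<forall>x. comb (S x) = (\<Sum>p\<in>{p. a p x \<noteq> 0}. lscale (fls_const (a p x)) (u p))) \<and>
    (\<forall>x k. (\<forall>p. a p x = 0) \<longrightarrow> S x k = 0)"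
proof -
  have "\<forall>p. \<exists>v. (\<forall>k\<ge>K. v k = 0) \<and> comb v = u p"
  proof
    fix p
    have "\<exists>v. (\<forall>n k. u p \<in> fil n \<longrightarrow> v k \<in> tadic n) \<and> (\<forall>k\<ge>K. v k = 0) \<and> comb v = u p"
      by (rule lift_filtered[of "u p"]) blast
    then show "\<exists>v. (\<forall>k\<ge>K. v k = 0) \<and> comb v = u p"
      by blast
  qed
  from choice[OF this] obtain W where W: "\<And>p k. k \<ge> K \<Longrightarrow> W p k = 0" "\<And>p. comb (W p) = u p"
    by blast
  define S where "S z k = (\<Sum>p\<in>{p. a p z \<noteq> 0}. fls_const (a p z) * W p k)" for z k
  have S_eq: "S z k = (\<Sum>p\<in>A. fls_const (a p z) * W p k)" if "finite A" "{p. a p z \<noteq> 0} \<subseteq> A" for z k A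
    unfolding S_def using that by (intro sum.mono_neutral_left) auto
  have "const_linear S"
    unfolding const_linear_def
  proof (intro conjI allI impI)
    show "S (x + y) k = S x k + S y k" for x y k
    proof -
      \<comment> \<open>A common finite index set for the sums at \<open>x\<close>, \<open>y\<close>
        and \<open>x + y\<close>, whose supports differ.\<close>
      define A where "A = {p. a p x \<noteq> 0} \<union> {p. a p y \<noteq> 0}"
      have "finite A"
        using a_fin by (simp add: A_def)
      then have "S z k = (\<Sum>p\<in>A. fls_const (a p z) * W p k)" if "z \<in> {x, y, x + y}" for z
        by (rule S_eq) (use that in \<open>auto simp: A_def a\<close>)
      then show ?thesis
        by (simp add: a sum.distrib distrib_right flip: fls_plus_const)
    qed
    show "S (lscale (fls_const r) x) k = fls_const r * S x k" for r x k
    proof -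
      have "S (lscale (fls_const r) x) k = (\<Sum>p\<in>{p. a p x \<noteq> 0}. fls_const (r * a p x) * W p k)"
        by (subst S_eq[OF a_fin[of x]]) (auto simp: a)
      also have "\<dots> = fls_const r * S x k"
        by (simp add: S_def sum_distrib_left mult.assoc flip: fls_const_mult_const)
      finally show ?thesis .
    qed
    show "S x k = 0" if "k \<ge> K" for x k
      using that by (simp add: S_def W)
  qed
  moreover have "comb (S x) = (\<Sum>p\<in>{p. a p x \<noteq> 0}. lscale (fls_const (a p x)) (u p))" for x
    unfolding S_def by (simp add: comb_sum comb_scale W)
  moreover have "S x k = 0" if "\<forall>p. a p x = 0" for x k
    using that by (simp add: S_def)
  ultimately show ?thesis
    by blast
qed

text \<open>The hypotheses are the Tate structure in coordinates: \<open>b\<close> and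
  \<open>e\<close> expand \<open>g\<close> as a convergent series, and \<open>a\<close> and
  \<open>u\<close> expand 1 - g as finite sums that vanish near 0.\<close>

theorem projective:
  assumes g: "\<And>x y. g (x + y) = g x + g y" "\<And>r x. g (lscale (fls_const r) x) = lscale (fls_const r) (g x)"
    and g_in: "\<And>x. g x \<in> L" and g_id: "\<And>x. x \<in> fil d \<Longrightarrow> g x = x"
    and b: "\<And>y x z. b y (x + z) = b y x + b y z" "\<And>y r x. b y (lscale (fls_const r) x) = r * b y x"
    and e_in: "\<And>y. e y \<in> L"
    and approx: "\<And>n. \<exists>J. finite J \<and> (\<forall>y. y \<notin> J \<longrightarrow> e y \<in> fil n) \<and>
      (\<forall>z. g z - (\<Sum>y\<in>J. lscale (fls_const (b y z)) (e y)) \<in> fil n)"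
    and a: "\<And>p x z. a p (x + z) = a p x + a p z" "\<And>p r x. a p (lscale (fls_const r) x) = r * a p x"
    and a_fin: "\<And>x. finite {p. a p x \<noteq> 0}"
    and a_sum: "\<And>x. x - g x = (\<Sum>p\<in>{p. a p x \<noteq> 0}. lscale (fls_const (a p x)) (u p))"
    and a_vanish: "\<And>p x. x \<in> fil d \<Longrightarrow> a p x = 0"
  shows "fg_projective_fls lscale"
proof -
  obtain G where G_lin: "const_linear G" and G_in: "\<forall>x k. G x k \<in> tadic 0" and comb_G: "\<forall>x. comb (G x) = g x"
    using lift_convergent_sum[OF b e_in approx] by blast
  obtain S where S_lin: "const_linear S"
    and comb_S: "\<forall>x. comb (S x) = (\<Sum>p\<in>{p. a p x \<noteq> 0}. lscale (fls_const (a p x)) (u p))"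
    and S_vanish: "\<forall>x k. (\<forall>p. a p x = 0) \<longrightarrow> S x k = 0"
    using lift_finite_sum[OF a a_fin, where u = u] by blast
  note G = const_linearD[OF G_lin]
  note S = const_linearD[OF S_lin]
  define s where "s x k = G x k + S x k" for x k
  have comb_s: "comb (s x) = x" for x
    unfolding s_def by (simp add: comb_add comb_G comb_S flip: a_sum)
  have s: "s (x + y) k = s x k + s y k" "s (lscale (fls_const r) x) k = fls_const r * s x k" for x y r k
    by (simp_all add: s_def G S distrib_left)
  \<comment> \<open>A bound on L suffices, since \<open>s\<close> is only applied to values of
    \<open>h\<close>. The summand \<open>G\<close> is integral everywhere, while \<open>S\<close>
    kills t^d L.\<close>
  have "\<exists>B. \<forall>x\<in>L. s x k \<in> tadic B" for k
  proof -
    have "\<exists>B. \<forall>x\<in>L. S x k \<in> tadic B"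
    proof (rule vanishing_bounded)
      show "S (x + y) k = S x k + S y k" for x y
        by (rule S(1))
      show "S (lscale (fls_const r) x) k = fls_const r * S x k" for r x
        by (rule S(2))
      show "S x k = 0" if "x \<in> fil d" for x
        using that a_vanish S_vanish by blast
    qed
    then obtain B where "\<forall>x\<in>L. S x k \<in> tadic B"
      by blast
    then have "\<forall>x\<in>L. s x k \<in> tadic (min 0 B)"
      using tadic_antimono[OF G_in[rule_format], of "min 0 B"]
      by (auto simp: s_def intro!: tadic_add intro: tadic_antimono)
    then show ?thesis by blast
  qed
  then obtain B' where B': "\<And>x k. x \<in> L \<Longrightarrow> s x k \<in> tadic (B' k)"
    by metis
  \<comment> \<open>The 0 keeps the set nonempty when \<open>K\<close> is 0; coordinates from
    \<open>K\<close> on vanish.\<close>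
  define B where "B = Min (insert 0 (B' ` {..<K}))"
  have B: "s x k \<in> tadic B" if "x \<in> L" for x k
  proof (cases "k < K")
    case True
    then have "B \<le> B' k"
      by (simp add: B_def)
    then show ?thesis
      using tadic_antimono B'[OF that] by blast
  qed (simp add: s_def G S)
  define h where "h x = g x - lscale (tpow 1) (g (lscale (tpow (- 1)) x))" for x
  have h: "h (x + y) = h x + h y" "h (lscale (fls_const r) x) = lscale (fls_const r) (h x)" for x y r
    by (simp_all add: h_def g scale_right_distrib scale_left_commute[of _ "fls_const r"]
        scale_right_diff_distrib del: scale_scale)
  have h_in: "h x \<in> L" for x
    using fil_diff[of "g x" 0 "lscale (tpow 1) (g (lscale (tpow (- 1)) x))"]
      fil_scale[OF tpow_tadic_ge[of 0 1], of "g (lscale (tpow (- 1)) x)" 0] g_in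
    by (simp add: h_def fil_0)
  \<comment> \<open>One power of t more than for \<open>g\<close>, since t^(-1) x must lie in t^d L
    too.\<close>
  have h_vanish: "h x = 0" if "x \<in> fil (d + 1)" for x
    using g_id[of x] g_id[of "lscale (tpow (- 1)) x"] fil_antimono[OF that, of d] fil_tpow[OF that, of "- 1"]
    by (simp add: h_def)
  have s_0: "s 0 k = 0" for k
    using s(1)[of 0 0] by simp
  have "\<exists>\<Phi>. (\<forall>x y. \<Phi> (x + y) = \<Phi> x + \<Phi> y) \<and> (\<forall>c x. \<Phi> (lscale c x) = c * \<Phi> x) \<and>
      (\<forall>x a lo hi. x \<in> fil a \<longrightarrow> lo \<le> a - (d + 1) \<longrightarrow>
      \<Phi> x - (\<Sum>n\<in>{lo..hi}. tpow n * s (h (lscale (tpow (- n)) x)) k) \<in> tadic (hi + B))" for k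
    by (rule average) (simp_all add: h s h_vanish s_0 B h_in)
  then have "\<forall>k. \<exists>\<Phi>. (\<forall>x y. \<Phi> (x + y) = \<Phi> x + \<Phi> y) \<and> (\<forall>c x. \<Phi> (lscale c x) = c * \<Phi> x) \<and>
      (\<forall>x a lo hi. x \<in> fil a \<longrightarrow> lo \<le> a - (d + 1) \<longrightarrow>
      \<Phi> x - (\<Sum>n\<in>{lo..hi}. tpow n * s (h (lscale (tpow (- n)) x)) k) \<in> tadic (hi + B))"
    by (rule allI)
  from choice[OF this] obtain \<Phi> where all: "\<forall>k. (\<forall>x y. \<Phi> k (x + y) = \<Phi> k x + \<Phi> k y) \<and>
      (\<forall>c x. \<Phi> k (lscale c x) = c * \<Phi> k x) \<and>
      (\<forall>x a lo hi. x \<in> fil a \<longrightarrow> lo \<le> a - (d + 1) \<longrightarrow>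
      \<Phi> k x - (\<Sum>n\<in>{lo..hi}. tpow n * s (h (lscale (tpow (- n)) x)) k) \<in> tadic (hi + B))" ..
  have \<Phi>: "\<Phi> k (x + y) = \<Phi> k x + \<Phi> k y" "\<Phi> k (lscale c x) = c * \<Phi> k x"
    "x \<in> fil a \<Longrightarrow> lo \<le> a - (d + 1) \<Longrightarrow>
      \<Phi> k x - (\<Sum>n\<in>{lo..hi}. tpow n * s (h (lscale (tpow (- n)) x)) k) \<in> tadic (hi + B)"
    for k x y c a lo hi
    using all by blast+
  have comb_\<Phi>: "comb (\<lambda>k. \<Phi> k x) = x" for x
  proof (rule fil_separated_eq)
    fix N :: int assume "N \<ge> 0"
    obtain a where a: "x \<in> fil a"
      using fil_absorbing by blast
    \<comment> \<open>\<open>lo\<close> is low enough that \<open>g\<close> fixes t^(-lo) x, so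
      \<open>q lo = x\<close>. \<open>hi\<close> is high enough that both the tail of
      \<open>\<Phi>\<close>, of order hi + B, and \<open>q (hi + 1)\<close> lie in step N. The terms
      0 and N in the bounds ensure lo \<le> hi.\<close>
    define lo where "lo = min 0 (a - (d + 1))"
    define hi where "hi = max N (N - B)"
    define q where "q n = lscale (tpow n) (g (lscale (tpow (- n)) x))" for n
    have "lscale (tpow n) (h (lscale (tpow (- n)) x)) = q n - q (n + 1)" for n
      by (simp add: h_def q_def scale_right_diff_distrib add.commute[of n] flip: tpow_add)
    then have "comb (\<lambda>k. \<Sum>n\<in>{lo..hi}. tpow n * s (h (lscale (tpow (- n)) x)) k)
        = (\<Sum>n\<in>{lo..hi}. q n - q (n + 1))"
      by (simp add: comb_sum comb_scale comb_s)
    also have "\<dots> = q lo - q (hi + 1)"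
    proof -
      have "(\<Sum>n\<in>{lo..lo + int m}. q n - q (n + 1)) = q lo - q (lo + int m + 1)" for m
      proof (induction m)
        case (Suc m)
        have "{lo..lo + int (Suc m)} = insert (lo + int (Suc m)) {lo..lo + int m}"
          by auto
        then show ?case
          using Suc by (simp add: algebra_simps)
      qed simp
      moreover have "lo \<le> hi"
        using \<open>N \<ge> 0\<close> by (simp add: lo_def hi_def)
      then obtain m where "hi = lo + int m"
        using zle_iff_zadd by blast
      ultimately show ?thesis
        by simp
    qed
    also have "q lo = x"
      using g_id[of "lscale (tpow (- lo)) x"] fil_antimono[OF fil_tpow[OF a, of "- lo"], of d]
      by (simp add: q_def lo_def)
    finally have "comb (\<lambda>k. \<Phi> k x) - x =
        comb (\<lambda>k. \<Phi> k x - (\<Sum>n\<in>{lo..hi}. tpow n * s (h (lscale (tpow (- n)) x)) k)) - q (hi + 1)"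
      by (simp add: comb_diff)
    also have "\<dots> \<in> fil N"
    proof (rule fil_diff)
      show "comb (\<lambda>k. \<Phi> k x - (\<Sum>n\<in>{lo..hi}. tpow n * s (h (lscale (tpow (- n)) x)) k)) \<in> fil N"
        by (intro comb_fil tadic_antimono[OF \<Phi>(3)[OF a]]) (simp_all add: lo_def hi_def)
      show "q (hi + 1) \<in> fil N"
        using fil_antimono[OF fil_tpow[of "g (lscale (tpow (- (hi + 1))) x)" 0 "hi + 1"], of N] g_in
        by (simp add: q_def fil_0 hi_def)
    qed
    finally show "comb (\<lambda>k. \<Phi> k x) - x \<in> fil N" .
  qed
  \<comment> \<open>A section must vanish from coordinate \<open>K\<close> on; \<open>comb\<close>
    does not see the cut.\<close>
  have retract: "comb (\<lambda>k. if k < K then \<Phi> k x else 0) = x" for x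
    using comb_\<Phi>[of x] by (simp add: comb_def)
  show ?thesis
    unfolding fg_projective_fls_def
    by (intro conjI exI[of _ K] exI[of _ "\<lambda>x k. if k < K then \<Phi> k x else 0"] exI[of _ comb])
       (auto simp: \<Phi> comb_add comb_scale retract module_axioms)
qed

end

section \<open>The topology of R((t)) and topological R((t))-modules\<close>

lemma openin_fls_topology:
  "openin fls_topology U \<longleftrightarrow> (\<forall>f\<in>U. \<exists>n. \<forall>g. g - f \<in> tadic n \<longrightarrow> g \<in> U)"
proof -
  have eq: "(\<lambda>U. \<forall>f\<in>U. \<exists>n::int. {g. \<forall>k<n. fls_nth (g - f) k = 0} \<subseteq> U)
      = (\<lambda>U. \<forall>f\<in>U. \<exists>n. \<forall>g. g - f \<in> tadic n \<longrightarrow> g \<in> U)"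
    by (auto simp: tadic_def fun_eq_iff subset_iff)
  \<comment> \<open>\<open>topology\<close> gives back its defining predicate only once that is
    known to satisfy the axioms.\<close>
  have "istopology (\<lambda>U. \<forall>f\<in>U. \<exists>n. \<forall>g. g - f \<in> tadic n \<longrightarrow> g \<in> (U :: 'a fls set))"
    unfolding istopology_def
  proof (intro conjI allI impI ballI)
    fix S T :: "'a fls set" and f
    assume S: "\<forall>f\<in>S. \<exists>n. \<forall>g. g - f \<in> tadic n \<longrightarrow> g \<in> S"
      and T: "\<forall>f\<in>T. \<exists>n. \<forall>g. g - f \<in> tadic n \<longrightarrow> g \<in> T" and f: "f \<in> S \<inter> T"
    obtain m where m: "\<forall>g. g - f \<in> tadic m \<longrightarrow> g \<in> S"
      using S f by blast
    obtain n where n: "\<forall>g. g - f \<in> tadic n \<longrightarrow> g \<in> T"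
      using T f by blast
    have "g \<in> S \<inter> T" if "g - f \<in> tadic (max m n)" for g
      using m n tadic_antimono[OF that, of m] tadic_antimono[OF that, of n] by simp
    then show "\<exists>n. \<forall>g. g - f \<in> tadic n \<longrightarrow> g \<in> S \<inter> T"
      by blast
  next
    fix \<K> :: "'a fls set set" and f
    assume "\<forall>S\<in>\<K>. \<forall>f\<in>S. \<exists>n. \<forall>g. g - f \<in> tadic n \<longrightarrow> g \<in> S" "f \<in> \<Union>\<K>"
    then show "\<exists>n. \<forall>g. g - f \<in> tadic n \<longrightarrow> g \<in> \<Union>\<K>"
      by (meson UnionE UnionI)
  qed
  then show ?thesis
    unfolding fls_topology_def eq by (simp add: topology_inverse')
qed

lemma topspace_fls_topology [simp]: "topspace fls_topology = UNIV"
proof -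
  have "openin (fls_topology :: 'a fls topology) UNIV"
    by (simp add: openin_fls_topology)
  then show ?thesis
    by (metis openin_subset top.extremum_unique)
qed

locale top_fls = module lscale
  for lscale :: "'r::comm_ring_1 fls \<Rightarrow> 'm::ab_group_add \<Rightarrow> 'm" +
  fixes \<tau> :: "'m topology"
  assumes top_fls_module: "top_fls_module lscale \<tau>"
begin

lemma topspace_UNIV [simp]: "topspace \<tau> = UNIV"
  using top_fls_module by (simp add: top_fls_module_def)

lemma openin_translation:
  assumes "openin \<tau> U"
  shows "openin \<tau> {x. a + x \<in> U}"
proof -
  have "continuous_map \<tau> (prod_topology \<tau> \<tau>) (\<lambda>x. (a, x))"
    by (simp add: continuous_map_pairedI)
  then have "continuous_map \<tau> \<tau> ((\<lambda>(x, y). x + y) \<circ> (\<lambda>x. (a, x)))"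
    using top_fls_module unfolding top_fls_module_def by (blast intro: continuous_map_compose)
  from openin_continuous_map_preimage[OF this assms] show ?thesis
    by simp
qed

text \<open>Each point s of S has the neighbourhood s + V inside S.\<close>

lemma openin_additive:
  assumes add: "\<And>x y. x \<in> S \<Longrightarrow> y \<in> S \<Longrightarrow> x + y \<in> S"
    and V: "openin \<tau> V" "0 \<in> V" "V \<subseteq> S"
  shows "openin \<tau> S"
proof (subst openin_subopen, intro ballI)
  fix s assume s: "s \<in> S"
  show "\<exists>T. openin \<tau> T \<and> s \<in> T \<and> T \<subseteq> S"
  proof (intro exI conjI)
    show "openin \<tau> {x. - s + x \<in> V}"
      by (rule openin_translation[OF V(1)])
    show "{x. - s + x \<in> V} \<subseteq> S"
    proof
      fix x assume "x \<in> {x. - s + x \<in> V}"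
      then have "s + (- s + x) \<in> S"
        using add s V(3) by blast
      then show "x \<in> S"
        by simp
    qed
  qed (use V in simp)
qed

lemma openin_scale_preimage:
  assumes "openin \<tau> U"
  shows "openin (prod_topology fls_topology \<tau>) {(f, x). lscale f x \<in> U}"
proof -
  have "continuous_map (prod_topology fls_topology \<tau>) \<tau> (\<lambda>(f, x). lscale f x)"
    using top_fls_module by (simp add: top_fls_module_def)
  from openin_continuous_map_preimage[OF this assms] show ?thesis
    by (simp add: split_def)
qed

text \<open>Joint continuity of the action at (0, x). The same \<open>n\<close> works for all of
  \<open>V\<close>, which later makes the lattice bounded.\<close>

lemma scale_continuous_zero:
  assumes "openin \<tau> U" "0 \<in> U"
  shows "\<exists>n V. openin \<tau> V \<and> x \<in> V \<and> (\<forall>f\<in>tadic n. \<forall>y\<in>V. lscale f y \<in> U)"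
proof -
  have "(0, x) \<in> {(f, x). lscale f x \<in> U}"
    using assms(2) by simp
  then obtain W V where W: "openin fls_topology W" "openin \<tau> V" "0 \<in> W" "x \<in> V"
    "W \<times> V \<subseteq> {(f, x). lscale f x \<in> U}"
    using openin_scale_preimage[OF assms(1)] unfolding openin_prod_topology_alt by meson
  then obtain n where "\<forall>g. g - 0 \<in> tadic n \<longrightarrow> g \<in> W"
    unfolding openin_fls_topology by blast
  then show ?thesis
    using W by (intro exI[of _ n] exI[of _ V]) auto
qed

lemma openin_scale_right:
  assumes "openin \<tau> U"
  shows "openin \<tau> {x. lscale f x \<in> U}"
proof -
  have "continuous_map \<tau> (prod_topology fls_topology \<tau>) (\<lambda>x. (f, x))"
    by (simp add: continuous_map_pairedI)
  from openin_continuous_map_preimage[OF this openin_scale_preimage[OF assms]] show ?thesis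
    by simp
qed

end

section \<open>Neighbourhoods of 0 in the sum of P and the dual of Q\<close>

text \<open>A basic open box constrains only finitely many values of a functional, and those
  coordinates form \<open>F\<close>.\<close>

lemma sum_dual_topology_nbhd:
  assumes W: "openin (sum_dual_topology scaleQ) W" "(0, \<lambda>_. 0) \<in> W"
  shows "\<exists>F. finite F \<and> (\<forall>\<phi>\<in>dual_module scaleQ. (\<forall>q\<in>F. \<phi> q = 0) \<longrightarrow> (0, \<phi>) \<in> W)"
proof -
  obtain A B where AB: "openin (discrete_topology UNIV) A"
    "openin (subtopology (product_topology (\<lambda>_. discrete_topology UNIV) UNIV) (dual_module scaleQ)) B"
    "0 \<in> A" "(\<lambda>_. 0) \<in> B" "A \<times> B \<subseteq> W"
    using W unfolding sum_dual_topology_def openin_prod_topology_alt by meson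
  obtain C where C: "openin (product_topology (\<lambda>_. discrete_topology UNIV) UNIV) C" "B = C \<inter> dual_module scaleQ"
    using AB(2) unfolding openin_subtopology by blast
  have "(\<lambda>_. 0) \<in> C"
    using AB(4) C(2) by blast
  then obtain X where X: "finite {i \<in> UNIV. X i \<noteq> topspace (discrete_topology UNIV)}"
    "(\<lambda>_. 0) \<in> Pi\<^sub>E UNIV X" "Pi\<^sub>E UNIV X \<subseteq> C"
    using C(1) unfolding openin_product_topology_alt by meson
  show ?thesis
  proof (intro exI[of _ "{i. X i \<noteq> UNIV}"] conjI ballI impI)
    show "finite {i. X i \<noteq> UNIV}"
      using X(1) by simp
    fix \<phi> assume \<phi>: "\<phi> \<in> dual_module scaleQ" "\<forall>q\<in>{i. X i \<noteq> UNIV}. \<phi> q = 0"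
    have "\<phi> q \<in> X q" for q
      using \<phi>(2) X(2) by (cases "X q = UNIV") (auto simp: PiE_iff)
    then have "\<phi> \<in> B"
      using X(3) C(2) \<phi>(1) by (auto simp: PiE_iff)
    then show "(0, \<phi>) \<in> W"
      using AB by blast
  qed
qed

lemma openin_sum_dual_topology:
  fixes scaleQ :: "'r::comm_ring_1 \<Rightarrow> 'q::ab_group_add \<Rightarrow> 'q"
  assumes "finite F"
  shows "openin (sum_dual_topology scaleQ) 
    {(a :: 'p::zero, \<phi>). a = 0 \<and> \<phi> \<in> dual_module scaleQ \<and> (\<forall>q\<in>F. \<phi> q = 0)}"
proof -
  define C where "C = Pi\<^sub>E UNIV (\<lambda>q. if q \<in> F then {0 :: 'r} else UNIV)"
  have "openin (product_topology (\<lambda>_. discrete_topology UNIV) UNIV) C"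
    unfolding C_def by (rule product_topology_basis) (use assms in \<open>auto intro: finite_subset\<close>)
  then have "openin (subtopology (product_topology (\<lambda>_. discrete_topology UNIV) UNIV) (dual_module scaleQ))
      (C \<inter> dual_module scaleQ)"
    by (rule openin_subtopology_Int)
  then have "openin (sum_dual_topology scaleQ) ({0 :: 'p} \<times> (C \<inter> dual_module scaleQ))"
    unfolding sum_dual_topology_def by (simp add: openin_prod_Times_iff)
  moreover have "{0 :: 'p} \<times> (C \<inter> dual_module scaleQ)
      = {(a, \<phi>). a = 0 \<and> \<phi> \<in> dual_module scaleQ \<and> (\<forall>q\<in>F. \<phi> q = 0)}"
    by (auto simp: C_def PiE_iff split: if_splits)
  ultimately show ?thesis
    by simp
qed

lemma dual_module_zero: "(\<lambda>_. 0) \<in> dual_module scaleQ"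
  by (simp add: dual_module_def)

lemma dual_module_add: "\<phi> \<in> dual_module scaleQ \<Longrightarrow> \<psi> \<in> dual_module scaleQ \<Longrightarrow> (\<lambda>q. \<phi> q + \<psi> q) \<in> dual_module scaleQ"
  by (simp add: dual_module_def algebra_simps)

lemma dual_module_scale: "\<phi> \<in> dual_module scaleQ \<Longrightarrow> (\<lambda>q. r * \<phi> q) \<in> dual_module scaleQ"
  by (simp add: dual_module_def algebra_simps)

lemma dual_module_sum:
  "(\<And>y. y \<in> J \<Longrightarrow> \<psi> y \<in> dual_module scaleQ) \<Longrightarrow> (\<lambda>q. \<Sum>y\<in>J. \<psi> y q) \<in> dual_module scaleQ"
  by (simp add: dual_module_def sum.distrib sum_distrib_left)

section \<open>The t-stable lattice in a Tate module\<close>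

text \<open>The Tate structure with fixed witnesses, R acting through constant series. The sections
  \<open>sP\<close> and \<open>sQ\<close> serve as dual bases of P and Q.\<close>

locale tate_fls = top_fls lscale \<tau>
  for lscale :: "'r::comm_ring_1 fls \<Rightarrow> 'm::ab_group_add \<Rightarrow> 'm" and \<tau> +
  fixes scaleP :: "'r \<Rightarrow> 'p::ab_group_add \<Rightarrow> 'p" and scaleQ :: "'r \<Rightarrow> 'q::ab_group_add \<Rightarrow> 'q"
    and i :: "'m \<Rightarrow> 'p \<times> ('q \<Rightarrow> 'r)" and p :: "'p \<times> ('q \<Rightarrow> 'r) \<Rightarrow> 'm"
    and sP :: "'p \<Rightarrow> 'p \<Rightarrow> 'r" and sQ :: "'q \<Rightarrow> 'q \<Rightarrow> 'r"
  assumes modP: "module scaleP"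
    and i_cont: "continuous_map \<tau> (sum_dual_topology scaleQ) i"
    and p_cont: "continuous_map (sum_dual_topology scaleQ) \<tau> p"
    and i_add: "i (x + y) = (fst (i x) + fst (i y), \<lambda>q. snd (i x) q + snd (i y) q)"
    and i_const: "i (lscale (fls_const r) x) = (scaleP r (fst (i x)), \<lambda>q. r * snd (i x) q)"
    and p_add: "\<phi> \<in> dual_module scaleQ \<Longrightarrow> \<psi> \<in> dual_module scaleQ \<Longrightarrow>
      p (a + b, \<lambda>q. \<phi> q + \<psi> q) = p (a, \<phi>) + p (b, \<psi>)"
    and p_const: "\<phi> \<in> dual_module scaleQ \<Longrightarrow>
      p (scaleP r a, \<lambda>q. r * \<phi> q) = lscale (fls_const r) (p (a, \<phi>))"
    and p_i: "p (i x) = x"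
    and sP_fin: "finite {y. sP a y \<noteq> 0}"
    and sP_add: "sP (a + b) = (\<lambda>z. sP a z + sP b z)"
    and sP_scale: "sP (scaleP r a) = (\<lambda>z. r * sP a z)"
    and sP_sum: "(\<Sum>y\<in>{y. sP a y \<noteq> 0}. scaleP (sP a y) y) = a"
    and sQ_fin: "finite {y. sQ c y \<noteq> 0}"
    and sQ_add: "sQ (c + d) = (\<lambda>z. sQ c z + sQ d z)"
    and sQ_scale: "sQ (scaleQ r c) = (\<lambda>z. r * sQ c z)"
    and sQ_sum: "(\<Sum>y\<in>{y. sQ c y \<noteq> 0}. scaleQ (sQ c y) y) = c"
begin

text \<open>The image in M of the coordinate functional at \<open>y\<close>.\<close>

definition e :: "'q \<Rightarrow> 'm" where "e y = p (0, \<lambda>q. sQ q y)"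

text \<open>Preimages under \<open>i\<close> of basic neighbourhoods of 0; \<open>nbhd {}\<close> is
  the preimage of the dual of Q.\<close>

definition nbhd :: "'q set \<Rightarrow> 'm set" where
  "nbhd F = {x. fst (i x) = 0 \<and> (\<forall>q\<in>F. snd (i x) q = 0)}"

text \<open>The R[t]-submodule generated by the image of the dual of Q. Stability under R and under
  all of R[[t]] is derived afterwards.\<close>

inductive_set L :: "'m set" where
  base: "\<phi> \<in> dual_module scaleQ \<Longrightarrow> lscale (tpow (int j)) (p (0, \<phi>)) \<in> L"
| add: "x \<in> L \<Longrightarrow> y \<in> L \<Longrightarrow> x + y \<in> L"

lemma snd_i_dual: "snd (i x) \<in> dual_module scaleQ"
proof -
  have "i x \<in> topspace (sum_dual_topology scaleQ)"
    using i_cont by (auto simp: continuous_map_def)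
  then show ?thesis
    by (auto simp: sum_dual_topology_def)
qed

lemma sQ_dual: "(\<lambda>q. sQ q y) \<in> dual_module scaleQ"
  by (simp add: dual_module_def sQ_add sQ_scale)

lemma p_zero [simp]: "p (0, \<lambda>_. 0) = 0"
  using p_add[OF dual_module_zero dual_module_zero, of 0 0] by simp

lemma i_zero [simp]: "i 0 = (0, \<lambda>_. 0)"
proof -
  have "fst (i 0) = fst (i 0) + fst (i 0)" "\<And>q. snd (i 0) q = snd (i 0) q + snd (i 0) q"
    using i_add[of 0 0] by (metis add_0 fst_conv, metis add_0 snd_conv)
  then show ?thesis
    by (simp add: prod_eq_iff fun_eq_iff)
qed

lemma sP_zero [simp]: "sP 0 y = 0"
  using fun_cong[OF sP_add[of 0 0], of y] by simp

lemma p_dual_const: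
  "\<phi> \<in> dual_module scaleQ \<Longrightarrow> p (0, \<lambda>q. r * \<phi> q) = lscale (fls_const r) (p (0, \<phi>))"
  using p_const[of \<phi> r 0] module.scale_zero_right[OF modP] by simp

lemma p_dual_sum:
  assumes "finite J" "\<And>y. y \<in> J \<Longrightarrow> \<psi> y \<in> dual_module scaleQ"
  shows "p (0, \<lambda>q. \<Sum>y\<in>J. c y * \<psi> y q) = (\<Sum>y\<in>J. lscale (fls_const (c y)) (p (0, \<psi> y)))"
  using assms
proof (induction J)
  case (insert y J)
  then have "(\<lambda>q. \<Sum>y\<in>J. c y * \<psi> y q) \<in> dual_module scaleQ" "(\<lambda>q. c y * \<psi> y q) \<in> dual_module scaleQ"
    by (auto intro!: dual_module_sum dual_module_scale)
  from p_add[OF this(2,1), of 0 0] show ?case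
    using insert by (simp add: p_dual_const)
qed simp

lemma p_discrete_sum:
  assumes "finite A"
  shows "p (\<Sum>a\<in>A. scaleP (c a) a, \<lambda>_. 0) = (\<Sum>a\<in>A. lscale (fls_const (c a)) (p (a, \<lambda>_. 0)))"
  using assms
proof (induction A)
  case (insert a A)
  from p_add[OF dual_module_zero dual_module_zero, of "scaleP (c a) a" "\<Sum>a\<in>A. scaleP (c a) a"]
  show ?case
    using insert p_const[OF dual_module_zero, of "c a" a] by simp
qed simp

text \<open>Apply the functional to the expansion of \<open>q\<close> given by \<open>sQ\<close>; a
  larger \<open>J\<close> only adds zeros.\<close>

lemma dual_expansion:
  assumes "\<phi> \<in> dual_module scaleQ" "finite J" "{y. sQ q y \<noteq> 0} \<subseteq> J"
  shows "\<phi> q = (\<Sum>y\<in>J. \<phi> y * sQ q y)"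
proof -
  interpret \<phi>: additive \<phi>
    using assms(1) by unfold_locales (simp add: dual_module_def)
  have "\<phi> q = \<phi> (\<Sum>y\<in>{y. sQ q y \<noteq> 0}. scaleQ (sQ q y) y)"
    by (simp add: sQ_sum)
  also have "\<dots> = (\<Sum>y\<in>{y. sQ q y \<noteq> 0}. \<phi> y * sQ q y)"
    using assms(1) by (simp add: \<phi>.sum dual_module_def mult.commute)
  also have "\<dots> = (\<Sum>y\<in>J. \<phi> y * sQ q y)"
    using assms(2,3) by (intro sum.mono_neutral_left) auto
  finally show ?thesis .
qed

lemma p_nbhd:
  assumes "openin \<tau> V" "0 \<in> V"
  shows "\<exists>F. finite F \<and> (\<forall>\<phi>\<in>dual_module scaleQ. (\<forall>q\<in>F. \<phi> q = 0) \<longrightarrow> p (0, \<phi>) \<in> V)"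
proof -
  define W where "W = {z \<in> topspace (sum_dual_topology scaleQ). p z \<in> V}"
  have "openin (sum_dual_topology scaleQ) W"
    unfolding W_def by (rule openin_continuous_map_preimage[OF p_cont assms(1)])
  moreover have "(0, \<lambda>_. 0) \<in> W"
    using assms(2) dual_module_zero by (auto simp: W_def sum_dual_topology_def)
  ultimately obtain F where "finite F" "\<forall>\<phi>\<in>dual_module scaleQ. (\<forall>q\<in>F. \<phi> q = 0) \<longrightarrow> (0, \<phi>) \<in> W"
    using sum_dual_topology_nbhd by blast
  then show ?thesis
    by (auto simp: W_def)
qed

text \<open>By continuity of \<open>p\<close>, functionals vanishing on a finite set F go into V.
  Let J collect the indices in the expansions of the elements of F: a functional and its partial
  expansion over J agree on F, and coordinate functionals outside J vanish there.\<close>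

lemma dual_approx:
  assumes "openin \<tau> V" "0 \<in> V"
  shows "\<exists>J. finite J \<and> (\<forall>y. y \<notin> J \<longrightarrow> e y \<in> V) \<and>
    (\<forall>\<phi>\<in>dual_module scaleQ. p (0, \<phi>) - (\<Sum>y\<in>J. lscale (fls_const (\<phi> y)) (e y)) \<in> V)"
proof -
  obtain F where F: "finite F" "\<forall>\<phi>\<in>dual_module scaleQ. (\<forall>q\<in>F. \<phi> q = 0) \<longrightarrow> p (0, \<phi>) \<in> V"
    using p_nbhd[OF assms] by blast
  define J where "J = (\<Union>q\<in>F. {y. sQ q y \<noteq> 0})"
  have J: "finite J"
    using F(1) sQ_fin by (simp add: J_def)
  have "e y \<in> V" if "y \<notin> J" for y
    unfolding e_def using that by (intro F(2)[rule_format] sQ_dual) (auto simp: J_def)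
  moreover have "p (0, \<phi>) - (\<Sum>y\<in>J. lscale (fls_const (\<phi> y)) (e y)) \<in> V"
    if \<phi>: "\<phi> \<in> dual_module scaleQ" for \<phi>
  proof -
    define \<psi> where "\<psi> q = (\<Sum>y\<in>J. \<phi> y * sQ q y)" for q
    define \<rho> where "\<rho> q = \<phi> q + - 1 * \<psi> q" for q
    have \<psi>: "\<psi> \<in> dual_module scaleQ"
      unfolding \<psi>_def by (intro dual_module_sum dual_module_scale sQ_dual)
    have \<rho>: "\<rho> \<in> dual_module scaleQ"
      unfolding \<rho>_def by (intro dual_module_add dual_module_scale \<phi> \<psi>)
    have "\<rho> q = 0" if "q \<in> F" for q
      using dual_expansion[OF \<phi> J, of q] that by (auto simp: \<rho>_def \<psi>_def J_def)
    then have "p (0, \<rho>) \<in> V"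
      using F(2) \<rho> by blast
    moreover have "p (0, \<phi>) = p (0, \<rho>) + p (0, \<psi>)"
      using p_add[OF \<rho> \<psi>, of 0 0] by (simp add: \<rho>_def)
    moreover have "p (0, \<psi>) = (\<Sum>y\<in>J. lscale (fls_const (\<phi> y)) (e y))"
      unfolding \<psi>_def e_def by (rule p_dual_sum[OF J sQ_dual])
    ultimately show ?thesis
      by simp
  qed
  ultimately show ?thesis
    using J by blast
qed

lemma nbhd_open: "finite F \<Longrightarrow> openin \<tau> (nbhd F)"
  using openin_continuous_map_preimage[OF i_cont openin_sum_dual_topology, of F] snd_i_dual
  by (simp add: nbhd_def split_def)

lemma nbhd_zero: "0 \<in> nbhd F"
  by (simp add: nbhd_def)

lemma nbhd_add: "x \<in> nbhd F \<Longrightarrow> y \<in> nbhd F \<Longrightarrow> x + y \<in> nbhd F"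
  by (simp add: nbhd_def i_add)

lemma nbhd_const: "x \<in> nbhd F \<Longrightarrow> lscale (fls_const r) x \<in> nbhd F"
  using module.scale_zero_right[OF modP] by (simp add: nbhd_def i_const)

lemma nbhd_sum: "(\<And>y. y \<in> J \<Longrightarrow> f y \<in> nbhd F) \<Longrightarrow> sum f J \<in> nbhd F"
  by (induction J rule: infinite_finite_induct) (auto intro: nbhd_zero nbhd_add)

lemma p_dual_in_L: "\<phi> \<in> dual_module scaleQ \<Longrightarrow> p (0, \<phi>) \<in> L"
  using L.base[of \<phi> 0] by simp

lemma e_in_L: "e y \<in> L"
  unfolding e_def by (rule p_dual_in_L[OF sQ_dual])

lemma L_zero: "0 \<in> L"
  using p_dual_in_L[OF dual_module_zero] by simp

lemma L_const: "x \<in> L \<Longrightarrow> lscale (fls_const r) x \<in> L"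
proof (induction rule: L.induct)
  case (base \<phi> j)
  have "lscale (fls_const r) (lscale (tpow (int j)) (p (0, \<phi>))) = lscale (tpow (int j)) (p (0, \<lambda>q. r * \<phi> q))"
    using base by (simp add: p_dual_const mult.commute)
  then show ?case
    using L.base[OF dual_module_scale[OF base]] by simp
qed (simp add: scale_right_distrib L.add)

lemma L_tpow: "x \<in> L \<Longrightarrow> lscale (tpow (int j)) x \<in> L"
proof (induction rule: L.induct)
  case (base \<phi> k)
  then show ?case
    using L.base[of \<phi> "j + k"] by (simp add: tpow_add)
qed (simp add: scale_right_distrib L.add)

lemma L_sum: "(\<And>y. y \<in> J \<Longrightarrow> f y \<in> L) \<Longrightarrow> sum f J \<in> L"
  by (induction J rule: infinite_finite_induct) (auto intro: L_zero L.add)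

lemma nbhd_subset_L: "nbhd {} \<subseteq> L"
proof
  fix x assume "x \<in> nbhd {}"
  then have "i x = (0, snd (i x))"
    by (simp add: nbhd_def prod_eq_iff)
  then show "x \<in> L"
    using p_dual_in_L[OF snd_i_dual[of x]] p_i[of x] by simp
qed

lemma L_open: "openin \<tau> L"
  using nbhd_open[of "{}"] by (intro openin_additive[OF L.add _ nbhd_zero nbhd_subset_L]) simp_all

text \<open>L is open, so a high tail of \<open>f\<close> sends \<open>x\<close> into L; what
  remains is a polynomial in t, under which L is stable.\<close>

lemma L_scale:
  assumes "f \<in> tadic 0" "x \<in> L"
  shows "lscale f x \<in> L"
proof -
  obtain n where n: "\<And>f. f \<in> tadic n \<Longrightarrow> lscale f x \<in> L"
    using scale_continuous_zero[OF L_open L_zero, of x] by blast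
  define q where "q = (\<Sum>j\<in>{0..<n}. fls_const (fls_nth f j) * tpow j)"
  have "lscale (fls_const c) (lscale (tpow j) x) \<in> L" if "j \<ge> 0" for j c
    using L_const[OF L_tpow[OF assms(2), of "nat j"]] that by simp
  then have "lscale q x \<in> L"
    unfolding q_def by (auto simp: scale_sum_left simp flip: scale_scale intro!: L_sum)
  moreover have "lscale (f - q) x \<in> L"
    using n fls_truncation[OF assms(1)] by (simp add: q_def)
  ultimately show ?thesis
    using L.add[of "lscale (f - q) x" "lscale q x"] by (simp flip: scale_left_distrib)
qed

text \<open>Modulo a neighbourhood \<open>V\<close> that high powers of t absorb uniformly, the
  image of the dual of Q is spanned over R by finitely many \<open>e y\<close>, each absorbed on its
  own.\<close>

lemma L_absorbed:
  assumes "finite F"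
  shows "\<exists>n. \<forall>m\<ge>n. \<forall>x\<in>L. lscale (tpow m) x \<in> nbhd F"
proof -
  obtain k V where V: "openin \<tau> V" "0 \<in> V" "\<forall>f\<in>tadic k. \<forall>y\<in>V. lscale f y \<in> nbhd F"
    using scale_continuous_zero[OF nbhd_open[OF assms] nbhd_zero] by blast
  obtain J where J: "finite J"
    "\<forall>\<phi>\<in>dual_module scaleQ. p (0, \<phi>) - (\<Sum>y\<in>J. lscale (fls_const (\<phi> y)) (e y)) \<in> V"
    using dual_approx[OF V(1,2)] by blast
  have "\<exists>n. \<forall>f\<in>tadic n. lscale f x \<in> nbhd F" for x
    using scale_continuous_zero[OF nbhd_open[OF assms] nbhd_zero, of x] by blast
  then obtain N where N: "\<And>x f. f \<in> tadic (N x) \<Longrightarrow> lscale f x \<in> nbhd F"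
    by metis
  define n where "n = Max (insert k ((\<lambda>y. N (e y)) ` J))"
  have absorb: "lscale (tpow m) (p (0, \<phi>)) \<in> nbhd F" if "m \<ge> n" and \<phi>: "\<phi> \<in> dual_module scaleQ" for m \<phi>
  proof -
    define r where "r = (\<Sum>y\<in>J. lscale (fls_const (\<phi> y)) (e y))"
    have "k \<le> m" and Nm: "\<And>y. y \<in> J \<Longrightarrow> N (e y) \<le> m"
      using that(1) J(1) by (auto simp: n_def)
    then have "lscale (tpow m) (p (0, \<phi>) - r) \<in> nbhd F"
      using V(3) J(2) \<phi> tpow_tadic_ge[of k m] unfolding r_def by blast
    moreover have r: "lscale (tpow m) r = (\<Sum>y\<in>J. lscale (fls_const (\<phi> y)) (lscale (tpow m) (e y)))"
      by (simp add: r_def scale_sum_right mult.commute)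
    have "lscale (tpow m) r \<in> nbhd F"
      unfolding r by (intro nbhd_sum nbhd_const N tpow_tadic_ge Nm)
    ultimately show ?thesis
      using nbhd_add[of "lscale (tpow m) (p (0, \<phi>) - r)" F "lscale (tpow m) r"]
      by (simp flip: scale_right_distrib)
  qed
  \<comment> \<open>The generators of L carry extra powers t^j with j \<ge> 0, which only raise the
    exponent, so the bound \<open>n\<close> remains valid.\<close>
  have "lscale (tpow m) x \<in> nbhd F" if "x \<in> L" "m \<ge> n" for x m
    using that
  proof (induction rule: L.induct)
    case (base \<phi> j)
    then show ?case
      using absorb[of "m + int j" \<phi>]
      by (simp add: tpow_add)
  qed (simp add: scale_right_distrib nbhd_add)
  then show ?thesis
    by blast
qed

text \<open>Writing x = t^n (t^(-n) x) with n large puts x into every \<open>nbhd F\<close> with F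
  finite, so \<open>i x\<close> is 0, and \<open>i\<close> is injective.\<close>

lemma L_separated:
  assumes "\<And>n. lscale (tpow (- n)) x \<in> L"
  shows "x = 0"
proof -
  have nbhd: "x \<in> nbhd F" if F: "finite F" for F
  proof -
    obtain n where "\<forall>m\<ge>n. \<forall>x\<in>L. lscale (tpow m) x \<in> nbhd F"
      using L_absorbed[OF F] by blast
    then have "lscale (tpow n) (lscale (tpow (- n)) x) \<in> nbhd F"
      using assms by blast
    then show ?thesis
      by simp
  qed
  have "fst (i x) = 0" "snd (i x) q = 0" for q
    using nbhd[of "{q}"] by (simp_all add: nbhd_def)
  then have "i x = (0, \<lambda>_. 0)"
    by (simp add: prod_eq_iff fun_eq_iff)
  then show ?thesis
    using p_i[of x] by simp
qed

lemma L_absorbing: "\<exists>n. lscale (tpow n) x \<in> L"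
  using scale_continuous_zero[OF L_open L_zero, of x] tpow_tadic by blast

lemma fls_lattice_exists: "\<exists>xs K. fls_lattice lscale L xs K"
proof -
  \<comment> \<open>This set is tL. Its openness lets finitely many \<open>e y\<close> span the
    image of the dual of Q modulo tL.\<close>
  have "openin \<tau> {x. lscale (tpow (- 1)) x \<in> L}"
    by (rule openin_scale_right[OF L_open])
  then obtain J where J: "finite J"
    "\<forall>\<phi>\<in>dual_module scaleQ. lscale (tpow (- 1)) (p (0, \<phi>) - (\<Sum>y\<in>J. lscale (fls_const (\<phi> y)) (e y))) \<in> L"
    using dual_approx[of "{x. lscale (tpow (- 1)) x \<in> L}"] L_zero by auto
  obtain f where f: "bij_betw f {0..<card J} J"
    using ex_bij_betw_nat_finite[OF J(1)] by blast
  define xs where "xs k = e (f k)" for k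
  have gen: "\<exists>r. lscale (tpow (- 1)) (x - (\<Sum>k<card J. lscale (fls_const (r k)) (xs k))) \<in> L" if "x \<in> L" for x
    using that
  proof (induction rule: L.induct)
    case (base \<phi> j)
    show ?case
    proof (cases j)
      case 0
      have "(\<Sum>y\<in>J. lscale (fls_const (\<phi> y)) (e y)) = (\<Sum>k<card J. lscale (fls_const (\<phi> (f k))) (xs k))"
        using sum.reindex_bij_betw[OF f, of "\<lambda>y. lscale (fls_const (\<phi> y)) (e y)"]
        by (simp add: xs_def atLeast0LessThan)
      then show ?thesis
        using J(2) base 0 by (intro exI[of _ "\<lambda>k. \<phi> (f k)"]) auto
    next
      case (Suc l)
      \<comment> \<open>Generators with a positive power of t already lie in tL, so zero
        coefficients work.\<close>
      then have "lscale (tpow (- 1)) (lscale (tpow (int j)) (p (0, \<phi>))) \<in> L"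
        using L.base[OF base, of l] by (simp flip: tpow_add)
      then show ?thesis
        by (intro exI[of _ "\<lambda>_. 0"]) simp
    qed
  next
    case (add x y)
    then obtain r s where "lscale (tpow (- 1)) (x - (\<Sum>k<card J. lscale (fls_const (r k)) (xs k))) \<in> L"
      "lscale (tpow (- 1)) (y - (\<Sum>k<card J. lscale (fls_const (s k)) (xs k))) \<in> L"
      by blast
    from L.add[OF this]
    have "lscale (tpow (- 1)) (x - (\<Sum>k<card J. lscale (fls_const (r k)) (xs k)) +
        (y - (\<Sum>k<card J. lscale (fls_const (s k)) (xs k)))) \<in> L"
      by (simp add: scale_right_distrib)
    moreover have "(\<Sum>k<card J. lscale (fls_const (r k + s k)) (xs k)) =
        (\<Sum>k<card J. lscale (fls_const (r k)) (xs k)) + (\<Sum>k<card J. lscale (fls_const (s k)) (xs k))"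
      by (simp add: sum.distrib scale_left_distrib flip: fls_plus_const)
    ultimately show ?case
      by (intro exI[of _ "\<lambda>k. r k + s k"]) (simp only: add_diff_add)
  qed
  have "fls_lattice lscale L xs (card J)"
    by unfold_locales
       (use L_zero L.add L_scale L_separated L_absorbing e_in_L gen in \<open>auto simp: xs_def\<close>)
  then show ?thesis
    by blast
qed

section \<open>Projectivity and the standard topology\<close>

theorem projective_standard: "fg_projective_fls lscale \<and> is_standard_topology lscale \<tau>"
proof -
  obtain xs K where "fls_lattice lscale L xs K"
    using fls_lattice_exists by blast
  then interpret lat: fls_lattice lscale L xs K .
  have fil_open: "openin \<tau> (lat.fil n)" for n
    unfolding lat.fil_def by (rule openin_scale_right[OF L_open])
  \<comment> \<open>On t^d L the component in P vanishes, so there \<open>g\<close> is the identity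
    and the coordinates \<open>a\<close> are 0.\<close>
  obtain d where d: "\<forall>m\<ge>d. \<forall>x\<in>L. lscale (tpow m) x \<in> nbhd {}"
    using L_absorbed[of "{}"] by blast
  have fil_nbhd: "fst (i x) = 0" if "x \<in> lat.fil d" for x
  proof -
    have "lscale (tpow d) (lscale (tpow (- d)) x) \<in> nbhd {}"
      using d that unfolding lat.fil_def by blast
    then show ?thesis
      by (simp add: nbhd_def)
  qed
  have "fg_projective_fls lscale"
  proof (rule lat.projective[where g = "\<lambda>x. p (0, snd (i x))" and b = "\<lambda>y x. snd (i x) y" and e = e
        and a = "\<lambda>y x. sP (fst (i x)) y" and u = "\<lambda>y. p (y, \<lambda>_. 0)" and d = d])
    show "p (0, snd (i (x + y))) = p (0, snd (i x)) + p (0, snd (i y))" for x y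
      using p_add[OF snd_i_dual snd_i_dual, of 0 0 x y] by (simp add: i_add)
    show "p (0, snd (i (lscale (fls_const r) x))) = lscale (fls_const r) (p (0, snd (i x)))" for r x
      by (simp add: i_const p_dual_const snd_i_dual)
    show "p (0, snd (i x)) = x" if "x \<in> lat.fil d" for x
      using fil_nbhd[OF that] p_i[of x] by (metis prod.collapse)
    show "\<exists>J. finite J \<and> (\<forall>y. y \<notin> J \<longrightarrow> e y \<in> lat.fil n) \<and>
        (\<forall>z. p (0, snd (i z)) - (\<Sum>y\<in>J. lscale (fls_const (snd (i z) y)) (e y)) \<in> lat.fil n)" for n
      using dual_approx[OF fil_open lat.fil_zero, of n] snd_i_dual by blast
    show "x - p (0, snd (i x)) =
        (\<Sum>y\<in>{y. sP (fst (i x)) y \<noteq> 0}. lscale (fls_const (sP (fst (i x)) y)) (p (y, \<lambda>_. 0)))" for x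
    proof -
      have "x = p (fst (i x), \<lambda>_. 0) + p (0, snd (i x))"
        using p_add[OF dual_module_zero snd_i_dual, of "fst (i x)" 0 x] p_i[of x] by simp
      then have "x - p (0, snd (i x)) = p (fst (i x), \<lambda>_. 0)"
        by (metis add_diff_cancel_right')
      also have "\<dots> = p (\<Sum>y\<in>{y. sP (fst (i x)) y \<noteq> 0}. scaleP (sP (fst (i x)) y) y, \<lambda>_. 0)"
        by (simp only: sP_sum)
      also have "\<dots> = (\<Sum>y\<in>{y. sP (fst (i x)) y \<noteq> 0}. lscale (fls_const (sP (fst (i x)) y)) (p (y, \<lambda>_. 0)))"
        by (rule p_discrete_sum[OF sP_fin])
      finally show ?thesis .
    qed
  qed (simp_all add: i_add i_const sP_add sP_scale sP_fin e_in_L p_dual_in_L snd_i_dual fil_nbhd)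
  moreover have "continuous_map \<tau> fls_topology \<phi>"
    if \<phi>: "\<forall>x y. \<phi> (x + y) = \<phi> x + \<phi> y" "\<forall>c x. \<phi> (lscale c x) = c * \<phi> x" for \<phi>
  proof -
    interpret \<phi>: additive \<phi>
      by unfold_locales (rule \<phi>(1)[rule_format])
    obtain A where A: "\<forall>n. \<forall>x\<in>lat.fil n. \<phi> x \<in> tadic (n - A)"
      using lat.linear_bounded[of \<phi>] \<phi> by blast
    have "openin \<tau> {x. \<phi> x \<in> W}" if W: "openin fls_topology W" for W
    proof (subst openin_subopen, intro ballI)
      fix x assume "x \<in> {x. \<phi> x \<in> W}"
      then obtain n where n: "\<forall>g. g - \<phi> x \<in> tadic n \<longrightarrow> g \<in> W"
        using W unfolding openin_fls_topology by blast
      show "\<exists>S. openin \<tau> S \<and> x \<in> S \<and> S \<subseteq> {x. \<phi> x \<in> W}"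
      \<comment> \<open>The functional loses at most \<open>A\<close> in degree, so x + t^(n+A) L is
        mapped into \<phi>(x) + t^n R[[t]].\<close>
      proof (intro exI[of _ "{y. - x + y \<in> lat.fil (n + A)}"] conjI subsetI)
        show "openin \<tau> {y. - x + y \<in> lat.fil (n + A)}"
          by (rule openin_translation[OF fil_open])
        show "y \<in> {x. \<phi> x \<in> W}" if "y \<in> {y. - x + y \<in> lat.fil (n + A)}" for y
          using A that n \<phi>.diff[of y x] by force
      qed simp
    qed
    then show ?thesis
      by (simp add: continuous_map_def)
  qed
  ultimately show ?thesis
    using top_fls_module by (simp add: is_standard_topology_def)
qed

end

theorem theorem3p10:
  fixes smul :: "'r::comm_ring_1 \<Rightarrow> 'm::ab_group_add \<Rightarrow> 'm"
    and \<tau> :: "'m topology"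
    and scaleP :: "'r \<Rightarrow> 'p::ab_group_add \<Rightarrow> 'p"
    and scaleQ :: "'r \<Rightarrow> 'q::ab_group_add \<Rightarrow> 'q"
    and T :: "'m \<Rightarrow> 'm"
    and lscale :: "'r fls \<Rightarrow> 'm \<Rightarrow> 'm"
  assumes tate: "tate_module_via smul \<tau> scaleP scaleQ"
    and aut: "top_automorphism smul \<tau> T"
    and nil: "top_nilpotent smul \<tau> T"
    and lmod: "top_fls_module lscale \<tau>"
    and compat: "\<forall>r x. lscale (fls_const r) x = smul r x"
    and t_act: "\<forall>x. lscale fls_X x = T x"
  shows "fg_projective_fls lscale \<and> is_standard_topology lscale \<tau>"
proof -
  obtain i p where cont: "continuous_map \<tau> (sum_dual_topology scaleQ) i"
      "continuous_map (sum_dual_topology scaleQ) \<tau> p"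
    and i: "\<forall>x y. i (x + y) = (fst (i x) + fst (i y), \<lambda>q. snd (i x) q + snd (i y) q)"
      "\<forall>r x. i (smul r x) = (scaleP r (fst (i x)), \<lambda>q. r * snd (i x) q)"
    and p: "\<forall>a \<phi> b \<psi>. \<phi> \<in> dual_module scaleQ \<longrightarrow> \<psi> \<in> dual_module scaleQ \<longrightarrow>
        p (a + b, \<lambda>q. \<phi> q + \<psi> q) = p (a, \<phi>) + p (b, \<psi>)"
      "\<forall>r a \<phi>. \<phi> \<in> dual_module scaleQ \<longrightarrow> p (scaleP r a, \<lambda>q. r * \<phi> q) = smul r (p (a, \<phi>))"
      "\<forall>x. p (i x) = x"
    using tate unfolding tate_module_via_def by (elim conjE exE) (rule that)
  have proj: "projective_module scaleP" "projective_module scaleQ"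
    using tate by (simp_all add: tate_module_via_def)
  obtain sP where sP: "\<forall>x. finite {y. sP x y \<noteq> 0}" "\<forall>x y. sP (x + y) = (\<lambda>z. sP x z + sP y z)"
    "\<forall>r x. sP (scaleP r x) = (\<lambda>z. r * sP x z)" "\<forall>x. (\<Sum>y\<in>{y. sP x y \<noteq> 0}. scaleP (sP x y) y) = x"
    using proj(1) unfolding projective_module_def by (elim conjE exE) (rule that)
  obtain sQ where sQ: "\<forall>x. finite {y. sQ x y \<noteq> 0}" "\<forall>x y. sQ (x + y) = (\<lambda>z. sQ x z + sQ y z)"
    "\<forall>r x. sQ (scaleQ r x) = (\<lambda>z. r * sQ x z)" "\<forall>x. (\<Sum>y\<in>{y. sQ x y \<noteq> 0}. scaleQ (sQ x y) y) = x"
    using proj(2) unfolding projective_module_def by (elim conjE exE) (rule that)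
  have modP: "module scaleP" and mod: "module lscale"
    using proj(1) lmod by (simp_all add: projective_module_def top_fls_module_def)
  \<comment> \<open>By \<open>compat\<close>, the R-structure on M is the restriction of
    \<open>lscale\<close> to constant series, the form used by the locale.\<close>
  have i_const: "\<forall>r x. i (lscale (fls_const r) x) = (scaleP r (fst (i x)), \<lambda>q. r * snd (i x) q)"
    by (simp add: compat i(2))
  have p_const: "\<forall>r a \<phi>. \<phi> \<in> dual_module scaleQ \<longrightarrow>
      p (scaleP r a, \<lambda>q. r * \<phi> q) = lscale (fls_const r) (p (a, \<phi>))"
    by (simp add: compat p(2))
  interpret tate_fls lscale \<tau> scaleP scaleQ i p sP sQ
    by (intro tate_fls.intro tate_fls_axioms.intro top_fls.intro top_fls_axioms.intro)
       ((rule mod lmod modP cont i(1)[rule_format] i_const[rule_format] p(1)[rule_format]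
          p_const[rule_format] p(3)[rule_format] sP[rule_format] sQ[rule_format]; assumption)+)
  show ?thesis
    by (rule projective_standard)
qed

end
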